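(* The backward shift operator $Z_-:\mathcal{H}(\Lambda)\to\mathcal{H}(\Lambda)$ is a left inverse of the forward shift operator $Z_+$ (i.e. $Z_-Z_+f=f$ for every $f\in\mathcal{H}(\Lambda)$), and the kernel of $Z_-$ consists of the constant DA functions.
   Context: **Lattice.** $\Lambda$ is a rhombic lattice in the complex plane $\mathbb{C}$: a monohedral (all tiles congruent), edge-to-edge tessellation of $\mathbb{C}$ with rhombi of side length $1$. $V(\Lambda)$ is its set of vertices; two vertices are adjacent if they are the endpoints of an edge of $\Lambda$. A path in $\Lambda$ from $a$ to $b$ is a finite sequence $(z_0,\dots,z_N)$ of vertices with $z_0=a$, $z_N=b$ and $z_{n-1},z_n$ adjacent for $n=1,\dots,N$; it is closed if $a=b$. Standing assumptions on $\Lambda$: (i) $0\in V(\Lambda)$; (ii) for every $z\in V(\Lambda)$ there are $N\in\mathbb{N}$ and a path $(z_0,\dots,z_N)$ with $z_0=z$, $z_n-z_{n-1}\neq\pm1$ for $n=1,\dots,N-1$, and $z_N-z_{N-1}=1$. **Discrete analyticity.** For $f:V(\Lambda)\to\mathbb{C}$ and a path $\gamma=(z_0,\dots,z_N)$, $\int_\gamma f\,\delta z=\sum_{n=1}^N\frac{f(z_{n-1})+f(z_n)}{2}(z_n-z_{n-1})$. $f$ is discrete analytic (DA) if $\int_\gamma f\,\delta z=0$ for every closed path $\gamma$; then $\int_a^b f\,\delta z$ denotes $\int_\gamma f\,\delta z$ for any path $\gamma$ from $a$ to $b$. $\mathcal{H}(\Lambda)$ is the complex vector space of DA functions on $V(\Lambda)$.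 **Shift operators.** $Z_+:\mathcal{H}(\Lambda)\to\mathcal{H}(\Lambda)$ is $(Z_+f)(z)=\frac{f(0)-f(z)}{2}+\int_0^z f\,\delta z$. It is injective with range $\{g\in\mathcal{H}(\Lambda):g(0)=0\}$, so one may define $Z_-:\mathcal{H}(\Lambda)\to\mathcal{H}(\Lambda)$ by letting $Z_-f$ be the unique element of $\mathcal{H}(\Lambda)$ with $(Z_+Z_-f)(z)=f(z)-f(0)$. *)

theory Defs
  imports "HOL-Analysis.Analysis"
begin

section \<open>Rhombic lattices\<close>

text \<open>For unit vectors, \<open>u \<noteq> v\<close> and \<open>u \<noteq> - v\<close> say that the rhombus is not degenerate.\<close>

definition unit_rhombus :: "complex set \<Rightarrow> bool" where
  "unit_rhombus T \<longleftrightarrow>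
     (\<exists>p u v. norm u = 1 \<and> norm v = 1 \<and> u \<noteq> v \<and> u \<noteq> - v \<and>
        T = convex hull {p, p + u, p + u + v, p + v})"

definition isometric_sets :: "complex set \<Rightarrow> complex set \<Rightarrow> bool" where
  "isometric_sets S T \<longleftrightarrow>
     (\<exists>h :: complex \<Rightarrow> complex. (\<forall>x y. dist (h x) (h y) = dist x y) \<and> h ` S = T)"

text \<open>A lattice is the set of its closed tiles; the vertices and edges of a tile are its extreme
  points and its one-dimensional faces.\<close>

definition tessellation :: "complex set set \<Rightarrow> bool" where
  "tessellation \<Lambda> \<longleftrightarrow>
     \<Union>\<Lambda> = UNIV \<and> (\<forall>S\<in>\<Lambda>. \<forall>T\<in>\<Lambda>. S \<noteq> T \<longrightarrow> interior S \<inter> interior T = {})"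

definition monohedral :: "complex set set \<Rightarrow> bool" where
  "monohedral \<Lambda> \<longleftrightarrow> (\<forall>S\<in>\<Lambda>. \<forall>T\<in>\<Lambda>. isometric_sets S T)"

definition edge_to_edge :: "complex set set \<Rightarrow> bool" where
  "edge_to_edge \<Lambda> \<longleftrightarrow>
     (\<forall>S\<in>\<Lambda>. \<forall>T\<in>\<Lambda>. S \<noteq> T \<longrightarrow>
        S \<inter> T = {} \<or>
        (\<exists>x. x extreme_point_of S \<and> x extreme_point_of T \<and> S \<inter> T = {x}) \<or>
        (\<exists>e. e edge_of S \<and> e edge_of T \<and> S \<inter> T = e))"

definition rhombic_lattice :: "complex set set \<Rightarrow> bool" where
  "rhombic_lattice \<Lambda> \<longleftrightarrow>
     tessellation \<Lambda> \<and> monohedral \<Lambda> \<and> edge_to_edge \<Lambda> \<and> (\<forall>T\<in>\<Lambda>. unit_rhombus T)"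

definition vertices :: "complex set set \<Rightarrow> complex set" where
  "vertices \<Lambda> = {x. \<exists>T\<in>\<Lambda>. x extreme_point_of T}"

definition adjacent :: "complex set set \<Rightarrow> complex \<Rightarrow> complex \<Rightarrow> bool" where
  "adjacent \<Lambda> a b \<longleftrightarrow> (\<exists>T\<in>\<Lambda>. closed_segment a b edge_of T)"

text \<open>The path \<open>(z\<^sub>0, \<dots>, z\<^sub>N)\<close> is the list \<open>zs\<close> with \<open>zs ! n = z\<^sub>n\<close> and
  \<open>length zs = N + 1\<close>.\<close>

definition lattice_path :: "complex set set \<Rightarrow> complex \<Rightarrow> complex \<Rightarrow> complex list \<Rightarrow> bool" where
  "lattice_path \<Lambda> a b zs \<longleftrightarrow>
     zs \<noteq> [] \<and> hd zs = a \<and> last zs = b \<and> set zs \<subseteq> vertices \<Lambda> \<and>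
     (\<forall>n\<in>{1..<length zs}. adjacent \<Lambda> (zs ! (n - 1)) (zs ! n))"

definition standing_assumptions :: "complex set set \<Rightarrow> bool" where
  "standing_assumptions \<Lambda> \<longleftrightarrow>
     0 \<in> vertices \<Lambda> \<and>
     (\<forall>z\<in>vertices \<Lambda>. \<exists>N\<ge>1. \<exists>b zs. lattice_path \<Lambda> z b zs \<and> length zs = N + 1 \<and>
        (\<forall>n\<in>{1..N - 1}. zs ! n - zs ! (n - 1) \<noteq> 1 \<and> zs ! n - zs ! (n - 1) \<noteq> - 1) \<and>
        zs ! N - zs ! (N - 1) = 1)"


section \<open>Discrete analytic functions\<close>

definition path_int :: "(complex \<Rightarrow> complex) \<Rightarrow> complex list \<Rightarrow> complex" where
  "path_int f zs =
     (\<Sum>n = 1..length zs - 1. (f (zs ! (n - 1)) + f (zs ! n)) / 2 * (zs ! n - zs ! (n - 1)))"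

text \<open>A function on \<open>vertices \<Lambda>\<close> is represented by its extensional extension to the plane, so
  that HOL equality of elements of \<open>DA \<Lambda>\<close> is equality on the vertices.\<close>

definition DA :: "complex set set \<Rightarrow> (complex \<Rightarrow> complex) set" where
  "DA \<Lambda> = {f \<in> extensional (vertices \<Lambda>). \<forall>a zs. lattice_path \<Lambda> a a zs \<longrightarrow> path_int f zs = 0}"

text \<open>For \<open>f \<in> DA \<Lambda>\<close> the value does not depend on the chosen path.\<close>

definition discrete_int ::
    "complex set set \<Rightarrow> complex \<Rightarrow> complex \<Rightarrow> (complex \<Rightarrow> complex) \<Rightarrow> complex" where
  "discrete_int \<Lambda> a b f = path_int f (SOME zs. lattice_path \<Lambda> a b zs)"

definition Z_plus :: "complex set set \<Rightarrow> (complex \<Rightarrow> complex) \<Rightarrow> complex \<Rightarrow> complex" where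
  "Z_plus \<Lambda> f = (\<lambda>z\<in>vertices \<Lambda>. (f 0 - f z) / 2 + discrete_int \<Lambda> 0 z f)"

definition Z_minus :: "complex set set \<Rightarrow> (complex \<Rightarrow> complex) \<Rightarrow> complex \<Rightarrow> complex" where
  "Z_minus \<Lambda> f = (THE g. g \<in> DA \<Lambda> \<and> (\<forall>z\<in>vertices \<Lambda>. Z_plus \<Lambda> g z = f z - f 0))"

end

theory Submission
  imports Defs
begin

text \<open>For \<open>f \<in> DA \<Lambda>\<close> and \<open>g = Z_plus \<Lambda> f\<close>, every edge from \<open>a\<close> to \<open>b = a + d\<close> gives
  \<open>f b * (d - 1) + f a * (d + 1) = 2 * (g b - g a)\<close>, the predicate \<open>shift_eq 1 f g\<close>.
  Conversely, a solution \<open>f\<close> of this edge equation has the primitive \<open>g + f / 2\<close>, so it is discrete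
  analytic and \<open>Z_plus \<Lambda> f = g - g 0\<close>. Everything therefore reduces to solving the edge equation
  uniquely for each \<open>g \<in> DA \<Lambda>\<close>: then \<open>Z_minus\<close> is well defined, and both claims follow by applying
  the injective operator \<open>Z_plus\<close>.

  Two facts about the lattice carry the proof. The first one (\<open>ex_primitive\<close>) is that an
  antisymmetric function on the edges whose sums along the two ways round every rhombus agree is the
  difference of a function on the vertices. It is proved as a vanishing statement for cocycles
  (\<open>cocycle_is_coboundary\<close>): each tile has its own primitive, the differences between the
  primitives of overlapping tiles form a cocycle on the cover of the plane by the tiles, and such a
  cocycle is trivial on small rectangles and can be glued along convex unions.

  Uniqueness: the equation propagates the value of \<open>f\<close> along every edge with \<open>d \<noteq> 1, - 1\<close>, and
  along an edge from \<open>x\<close> to \<open>x + 1\<close> it says \<open>f x = g (x + 1) - g x\<close>. The second standing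
  assumption connects every vertex to such an exit edge by edges that propagate. The values
  so obtained form the relation \<open>determined\<close>; existence of a solution means that they do not depend
  on the chosen route.

  To see this, replace the constant 1 by a real \<open>\<mu> > 1\<close>. No edge is then exceptional, the coefficients
  never vanish, and the consistency condition round a rhombus is exactly discrete analyticity of \<open>g\<close>,
  so a global solution that vanishes at a prescribed vertex exists
  (\<open>ex_perturbed_solution\<close>: variation of constants with a discrete exponential). Let this vertex be
  the far end \<open>x + 1\<close> of an exit edge, and let \<open>\<mu>\<close> tend to 1. The solutions
  converge at all vertices on the level of \<open>x\<close>, and the limit agrees with the determined values,
  provided that the solutions stay bounded at \<open>y + 1\<close> for every other exit edge from a vertex \<open>y\<close> on
  this level.

  This is where the second geometric fact enters (\<open>same_level_exits\<close>): the vertices \<open>x + 1\<close> and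
  \<open>y + 1\<close> are joined by edges other than \<open>1\<close> and \<open>- 1\<close>. The rhombi with a side parallel to the real
  axis form strips that cross all horizontal lines. The height that counts the signed steps \<open>1\<close> extends
  to a function on the plane that is nondecreasing along horizontal lines and grows by one
  across each strip. Two different strips starting at the same height would cross a common
  horizontal line one after the other, so the second one would start at least one unit higher.\<close>

section \<open>Unit rhombi\<close>

definition frame :: "complex \<Rightarrow> complex \<Rightarrow> bool" where
  "frame u v \<longleftrightarrow> norm u = 1 \<and> norm v = 1 \<and> u \<noteq> v \<and> u \<noteq> - v"

definition rhomb :: "complex \<Rightarrow> complex \<Rightarrow> complex \<Rightarrow> complex set" where
  "rhomb p u v = convex hull {p, p + u, p + u + v, p + v}"

lemma unit_rhombus_iff: "unit_rhombus T \<longleftrightarrow> (\<exists>p u v. frame u v \<and> T = rhomb p u v)"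
  by (auto simp: unit_rhombus_def frame_def rhomb_def)

lemma frame_sym: "frame u v \<Longrightarrow> frame v u"
  and frame_flip: "frame u v \<Longrightarrow> frame (- u) v"
  by (auto simp: frame_def equation_minus_iff)

lemma rhomb_swap: "rhomb p u v = rhomb p v u"
  by (simp add: rhomb_def insert_commute add_ac)

lemma rhomb_flip: "rhomb p u v = rhomb (p + u) (- u) v"
  by (simp add: rhomb_def insert_commute add_ac)

lemma rhomb_flip2: "rhomb p u v = rhomb (p + v) u (- v)"
  by (simp add: rhomb_def insert_commute add_ac)

lemma mem_rhomb_iff:
  "z \<in> rhomb p u v \<longleftrightarrow>
     (\<exists>s t. 0 \<le> s \<and> s \<le> 1 \<and> 0 \<le> t \<and> t \<le> 1 \<and> z = p + of_real s * u + of_real t * v)"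
  (is "_ \<longleftrightarrow> ?R z")
proof
  have "rhomb p u v \<subseteq> Collect ?R"
    unfolding rhomb_def
  proof (rule hull_minimal)
    have "?R p" by (intro exI[of _ 0]) auto
    moreover have "?R (p + u)" by (rule exI[of _ 1], rule exI[of _ 0]) auto
    moreover have "?R (p + u + v)" by (intro exI[of _ 1]) auto
    moreover have "?R (p + v)" by (rule exI[of _ 0], rule exI[of _ 1]) auto
    ultimately show "{p, p + u, p + u + v, p + v} \<subseteq> Collect ?R" by blast
    show "convex (Collect ?R)"
    proof (rule convexI)
      fix x y and a b :: real
      assume x: "x \<in> Collect ?R" and y: "y \<in> Collect ?R" and ab: "0 \<le> a" "0 \<le> b" "a + b = 1"
      from x obtain s t where 1: "0 \<le> s" "s \<le> 1" "0 \<le> t" "t \<le> 1"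
        "x = p + of_real s * u + of_real t * v" by blast
      from y obtain s' t' where 2: "0 \<le> s'" "s' \<le> 1" "0 \<le> t'" "t' \<le> 1"
        "y = p + of_real s' * u + of_real t' * v" by blast
      have "a *\<^sub>R x + b *\<^sub>R y = of_real (a + b) * p + of_real (a * s + b * s') * u + of_real (a * t + b * t') * v"
        using 1 2 by (simp add: scaleR_conv_of_real algebra_simps)
      moreover have "a * s + b * s' \<le> 1" "a * t + b * t' \<le> 1"
        using ab 1 2 convex_bound_le[of s 1 s' a b] convex_bound_le[of t 1 t' a b] by auto
      ultimately show "a *\<^sub>R x + b *\<^sub>R y \<in> Collect ?R"
        using ab 1 2 by (intro CollectI exI[of _ "a * s + b * s'"] exI[of _ "a * t + b * t'"]) auto
    qed
  qed
  then show "z \<in> rhomb p u v \<Longrightarrow> ?R z" by blast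
next
  assume "?R z"
  then obtain s t where st: "0 \<le> s" "s \<le> 1" "0 \<le> t" "t \<le> 1"
    "z = p + of_real s * u + of_real t * v" by blast
  have c: "convex (rhomb p u v)" by (simp add: rhomb_def)
  have m: "p \<in> rhomb p u v" "p + u \<in> rhomb p u v" "p + u + v \<in> rhomb p u v" "p + v \<in> rhomb p u v"
    unfolding rhomb_def by (auto intro: hull_inc)
  have "(1 - s) *\<^sub>R p + s *\<^sub>R (p + u) \<in> rhomb p u v"
    "(1 - s) *\<^sub>R (p + v) + s *\<^sub>R (p + u + v) \<in> rhomb p u v"
    using st convexD[OF c m(1) m(2), of "1 - s" s] convexD[OF c m(4) m(3), of "1 - s" s] by auto
  then have "(1 - t) *\<^sub>R ((1 - s) *\<^sub>R p + s *\<^sub>R (p + u))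
      + t *\<^sub>R ((1 - s) *\<^sub>R (p + v) + s *\<^sub>R (p + u + v)) \<in> rhomb p u v"
    using st by (intro convexD[OF c, where u = "1 - t" and v = t]) simp_all
  also have "(1 - t) *\<^sub>R ((1 - s) *\<^sub>R p + s *\<^sub>R (p + u))
      + t *\<^sub>R ((1 - s) *\<^sub>R (p + v) + s *\<^sub>R (p + u + v)) = z"
    by (simp add: st scaleR_conv_of_real algebra_simps)
  finally show "z \<in> rhomb p u v" .
qed

text \<open>The number \<open>Im (cnj u * v)\<close> is the determinant of \<open>u\<close> and
  \<open>v\<close>; two real-dependent unit vectors are equal or opposite.\<close>

lemma frame_det_nonzero:
  assumes "frame u v"
  shows "Im (cnj u * v) \<noteq> 0"
proof
  assume "Im (cnj u * v) = 0"
  then obtain r where r: "cnj u * v = of_real r"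
    by (metis complex_is_Real_iff Reals_cases)
  have uu: "u * cnj u = 1" using assms by (simp add: complex_norm_square[symmetric] frame_def)
  have v: "v = of_real r * u"
    using arg_cong[OF r, of "\<lambda>z. u * z"] uu by (simp add: mult.assoc[symmetric] mult.commute)
  then have "\<bar>r\<bar> = 1" using assms by (auto simp: frame_def norm_mult)
  then have "r = 1 \<or> r = -1" by linarith
  then show False using v assms by (auto simp: frame_def)
qed

lemma inner_ii_frame: "(\<i> * u) \<bullet> v = Im (cnj u * v)" "(\<i> * u) \<bullet> u = 0"
  by (auto simp: inner_complex_def algebra_simps)

text \<open>A side is cut out by the supporting line through it.\<close>

lemma side_face_of_rhomb:
  assumes "frame u v"
  shows "closed_segment p (p + u) face_of rhomb p u v"
proof -
  define k where "k = Im (cnj u * v)"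
  define a where "a = k *\<^sub>R (\<i> * u)"
  have k: "k \<noteq> 0" using frame_det_nonzero[OF assms] by (simp add: k_def)
  have a: "a \<bullet> (p + of_real s * u + of_real t * v) = a \<bullet> p + t * k\<^sup>2" for s t
    using inner_ii_frame(1)[of u v] inner_ii_frame(2)[of u]
    by (simp add: inner_add_right a_def scaleR_conv_of_real[symmetric] k_def power2_eq_square)
  have "(rhomb p u v \<inter> {z. a \<bullet> z = a \<bullet> p}) face_of rhomb p u v"
    by (rule face_of_Int_supporting_hyperplane_ge) (auto simp: mem_rhomb_iff a, simp add: rhomb_def)
  also have "rhomb p u v \<inter> {z. a \<bullet> z = a \<bullet> p} = closed_segment p (p + u)"
  proof (intro set_eqI iffI)
    fix z assume "z \<in> rhomb p u v \<inter> {z. a \<bullet> z = a \<bullet> p}"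
    then obtain s t where z: "0 \<le> s" "s \<le> 1" "z = p + of_real s * u + of_real t * v"
      "a \<bullet> z = a \<bullet> p" by (auto simp: mem_rhomb_iff)
    then have "t = 0" using k by (simp add: a)
    then show "z \<in> closed_segment p (p + u)"
      using z by (auto simp: in_segment scaleR_conv_of_real algebra_simps intro!: exI[of _ s])
  next
    fix z assume "z \<in> closed_segment p (p + u)"
    then obtain s where s: "0 \<le> s" "s \<le> 1" "z = p + of_real s * u + of_real 0 * v"
      by (auto simp: in_segment scaleR_conv_of_real algebra_simps)
    then have "z \<in> rhomb p u v" by (subst mem_rhomb_iff) (intro exI[of _ s] exI[of _ 0], simp)
    then show "z \<in> rhomb p u v \<inter> {z. a \<bullet> z = a \<bullet> p}" using a[of s 0] s by simp
  qed
  finally show ?thesis .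
qed

lemma side_edge_of_rhomb:
  assumes "frame u v"
  shows "closed_segment p (p + u) edge_of rhomb p u v"
proof -
  have "u \<noteq> 0" using assms by (auto simp: frame_def)
  then show ?thesis
    using side_face_of_rhomb[OF assms]
    by (simp add: edge_of_def segment_convex_hull aff_dim_convex_hull)
qed

lemma sides_edge_of_rhomb:
  assumes "frame u v"
  shows "closed_segment p (p + u) edge_of rhomb p u v"
    "closed_segment p (p + v) edge_of rhomb p u v"
    "closed_segment (p + u) (p + u + v) edge_of rhomb p u v"
    "closed_segment (p + v) (p + u + v) edge_of rhomb p u v"
proof -
  show "closed_segment p (p + u) edge_of rhomb p u v" by (rule side_edge_of_rhomb[OF assms])
  show "closed_segment p (p + v) edge_of rhomb p u v"
    using side_edge_of_rhomb[OF frame_sym[OF assms]] by (simp add: rhomb_swap)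
  show "closed_segment (p + u) (p + u + v) edge_of rhomb p u v"
    using side_edge_of_rhomb[OF frame_sym[OF frame_flip[OF assms]], of "p + u"]
    by (metis rhomb_flip rhomb_swap)
  have "frame u (- v)" using assms frame_sym frame_flip by blast
  from side_edge_of_rhomb[OF this, of "p + v"] 
  show "closed_segment (p + v) (p + u + v) edge_of rhomb p u v"
    by (simp add: rhomb_flip2[of p u v] add_ac)
qed

lemma extreme_point_of_rhomb:
  assumes "frame u v"
  shows "z extreme_point_of rhomb p u v \<longleftrightarrow> z \<in> {p, p + u, p + u + v, p + v}"
proof
  show "z extreme_point_of rhomb p u v \<Longrightarrow> z \<in> {p, p + u, p + u + v, p + v}"
    unfolding rhomb_def by (rule extreme_point_of_convex_hull)
  have "a extreme_point_of rhomb p u v \<and> b extreme_point_of rhomb p u v"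
    if "closed_segment a b edge_of rhomb p u v" for a b
    using that extreme_point_of_face extreme_point_of_segment unfolding edge_of_def by blast
  then show "z \<in> {p, p + u, p + u + v, p + v} \<Longrightarrow> z extreme_point_of rhomb p u v"
    using sides_edge_of_rhomb[OF assms] by blast
qed

text \<open>The two diagonals cross at their midpoints, so a face that contains one of them contains the other
  as well.\<close>

lemma diagonal_not_face:
  assumes "frame u v"
  shows "\<not> closed_segment p (p + u + v) face_of rhomb p u v"
proof
  assume F: "closed_segment p (p + u + v) face_of rhomb p u v"
  have uv: "u \<noteq> 0" "v \<noteq> 0" "u \<noteq> v" using assms by (auto simp: frame_def)
  have "midpoint p (p + u + v) = midpoint (p + u) (p + v)"
    by (simp add: midpoint_def algebra_simps)
  moreover have "midpoint (p + u) (p + v) \<in> open_segment (p + u) (p + v)"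
    using uv by simp
  moreover have "midpoint p (p + u + v) \<in> closed_segment p (p + u + v)" by simp
  moreover have ext: "(p + u) extreme_point_of rhomb p u v" "(p + v) extreme_point_of rhomb p u v"
    using extreme_point_of_rhomb[OF assms] by auto
  ultimately have "p + u \<in> closed_segment p (p + u + v)"
    using face_ofD[OF F, of "midpoint p (p + u + v)" "p + u" "p + v"]
    by (auto simp: extreme_point_of_def)
  then have "(p + u) extreme_point_of closed_segment p (p + u + v)"
    using extreme_point_of_face[OF F] ext by blast
  then show False using uv by (auto simp: extreme_point_of_segment)
qed

text \<open>An edge joins two extreme points, and \<open>diagonal_not_face\<close> leaves only the four sides,
  each in two directions.\<close>

lemma edge_of_rhomb_cases:
  assumes uv: "frame u v" and e: "closed_segment a b edge_of rhomb p u v"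
  obtains "a = p" "b = p + u" | "a = p" "b = p + v" | "a = p + u" "b = p"
    | "a = p + u" "b = p + u + v" | "a = p + u + v" "b = p + u" | "a = p + u + v" "b = p + v"
    | "a = p + v" "b = p" | "a = p + v" "b = p + u + v"
proof -
  have F: "closed_segment a b face_of rhomb p u v" using e by (simp add: edge_of_def)
  have ne: "a \<noteq> b" using e by (auto simp: edge_of_def)
  have "a extreme_point_of rhomb p u v" "b extreme_point_of rhomb p u v"
    using extreme_point_of_face[OF F] by (auto simp: extreme_point_of_segment)
  then have ab: "a \<in> {p, p + u, p + u + v, p + v}" "b \<in> {p, p + u, p + u + v, p + v}"
    using extreme_point_of_rhomb[OF uv] by auto
  have d1: "\<not> closed_segment p (p + u + v) face_of rhomb p u v"
    by (rule diagonal_not_face[OF uv])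
  have d2: "\<not> closed_segment (p + u) (p + v) face_of rhomb p u v"
    using diagonal_not_face[OF frame_flip[OF uv], of "p + u"] unfolding rhomb_flip[of p u v] by simp
  have "\<not> (a = p \<and> b = p + u + v)" "\<not> (b = p \<and> a = p + u + v)"
    "\<not> (a = p + u \<and> b = p + v)" "\<not> (b = p + u \<and> a = p + v)"
    using d1 d2 F closed_segment_commute by metis+
  with ab ne that show ?thesis by auto
qed

text \<open>Every edge can serve as the base side of the rhombus; this removes the choice of a corner from
  later arguments.\<close>

lemma rhombus_from_edge:
  assumes "unit_rhombus T" "closed_segment a b edge_of T"
  obtains w where "frame (b - a) w" "T = rhomb a (b - a) w"
proof -
  obtain p u v where uv: "frame u v" and T: "T = rhomb p u v"
    using assms(1) by (auto simp: unit_rhombus_iff)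
  have f: "frame (- u) v" "frame u (- v)" "frame (- u) (- v)"
    "frame v u" "frame (- v) u" "frame v (- u)" "frame (- v) (- u)"
    using uv frame_sym frame_flip by blast+
  have r: "T = rhomb (p + u) (- u) v" "T = rhomb (p + v) u (- v)" "T = rhomb (p + u + v) (- u) (- v)"
    "T = rhomb p v u" "T = rhomb (p + u) v (- u)" "T = rhomb (p + v) (- v) u"
    "T = rhomb (p + u + v) (- v) (- u)"
    unfolding T
    by (metis rhomb_flip rhomb_flip2 rhomb_swap)+
  from uv assms(2)[unfolded T] show ?thesis
  proof (cases rule: edge_of_rhomb_cases)
    case 1 then show ?thesis using that[of v] uv T by simp
  next
    case 2 then show ?thesis using that[of u] f r by simp
  next
    case 3 then show ?thesis using that[of v] f r by simp
  next
    case 4 then show ?thesis using that[of "-u"] f r by simp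
  next
    case 5 then show ?thesis using that[of "-u"] f r by simp
  next
    case 6 then show ?thesis using that[of "-v"] f r by simp
  next
    case 7 then show ?thesis using that[of u] f r by simp
  next
    case 8 then show ?thesis using that[of "-v"] f r by (simp add: add_ac)
  qed
qed

lemma norm_of_edge:
  assumes "unit_rhombus T" "closed_segment a b edge_of T"
  shows "norm (b - a) = 1"
  using rhombus_from_edge[OF assms] unfolding frame_def by blast

text \<open>Cramer's rule turns a small displacement \<open>z - c\<close> into small changes of both
  coordinates.\<close>

lemma rhomb_interior:
  assumes "frame u v" "0 < s" "s < 1" "0 < t" "t < 1"
  shows "p + of_real s * u + of_real t * v \<in> interior (rhomb p u v)"
proof -
  define k where "k = Im (cnj u * v)"
  define c where "c = p + of_real s * u + of_real t * v"
  define e where "e = min (min s (1 - s)) (min t (1 - t))"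
  have k: "k \<noteq> 0" using frame_det_nonzero[OF assms(1)] by (simp add: k_def)
  have e: "e > 0" using assms by (simp add: e_def)
  have "ball c (e * \<bar>k\<bar>) \<subseteq> rhomb p u v"
  proof
    fix z assume z: "z \<in> ball c (e * \<bar>k\<bar>)"
    define w where "w = z - c"
    define a b where "a = - Im (cnj v * w) / k" and "b = Im (cnj u * w) / k"
    have kw: "of_real k * w = - of_real (Im (cnj v * w)) * u + of_real (Im (cnj u * w)) * v"
      by (simp add: complex_eq_iff k_def algebra_simps)
    have "w = of_real k * w / of_real k" using k by simp
    then have w: "w = of_real a * u + of_real b * v"
      unfolding kw by (simp add: a_def b_def add_divide_distrib diff_divide_distrib left_diff_distrib)
    have nw: "norm w < e * \<bar>k\<bar>" using z by (simp add: w_def dist_norm norm_minus_commute)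
    have "\<bar>Im (cnj v * w)\<bar> \<le> norm w" "\<bar>Im (cnj u * w)\<bar> \<le> norm w"
      using assms abs_Im_le_cmod[of "cnj v * w"] abs_Im_le_cmod[of "cnj u * w"]
      by (auto simp: norm_mult frame_def)
    moreover have "\<bar>x\<bar> \<le> norm w \<Longrightarrow> \<bar>x / k\<bar> \<le> e" for x :: real
      using nw k by (simp add: abs_divide pos_divide_le_eq)
    ultimately have "\<bar>a\<bar> \<le> e" "\<bar>b\<bar> \<le> e"
      unfolding a_def b_def by (metis abs_minus_cancel, blast)
    moreover have "z = p + of_real (s + a) * u + of_real (t + b) * v"
      using w by (simp add: w_def c_def algebra_simps)
    ultimately show "z \<in> rhomb p u v"
      unfolding mem_rhomb_iff by (intro exI[of _ "s + a"] exI[of _ "t + b"]) (auto simp: e_def)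
  qed
  then show ?thesis using k e unfolding c_def[symmetric] mem_interior
    by (intro exI[of _ "e * \<bar>k\<bar>"]) auto
qed

lemma dist_rhomb_le:
  assumes "frame u v" "x \<in> rhomb p u v" "y \<in> rhomb p u v"
  shows "dist x y \<le> 2"
proof -
  obtain s t s' t' where st: "0 \<le> s" "s \<le> 1" "0 \<le> t" "t \<le> 1" "x = p + of_real s * u + of_real t * v"
    "0 \<le> s'" "s' \<le> 1" "0 \<le> t'" "t' \<le> 1" "y = p + of_real s' * u + of_real t' * v"
    using assms(2,3) by (auto simp: mem_rhomb_iff)
  have "x - y = of_real (s - s') * u + of_real (t - t') * v" by (simp add: st algebra_simps)
  then have "norm (x - y) \<le> norm (of_real (s - s') * u) + norm (of_real (t - t') * v)"
    using norm_triangle_ineq by metis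
  also have "\<dots> = \<bar>s - s'\<bar> + \<bar>t - t'\<bar>"
    using assms(1) by (simp add: norm_mult frame_def del: of_real_diff)
  finally show ?thesis using st by (auto simp: dist_norm)
qed

section \<open>Cocycles on locally finite covers of the plane\<close>

text \<open>The axiom \<open>star\<close> is local finiteness in the form in which it is used: near
  \<open>x\<close> only the tiles through \<open>x\<close> are visible.\<close>

locale closed_convex_cover =
  fixes \<Lambda> :: "complex set set"
  assumes cover: "\<Union>\<Lambda> = UNIV"
    and closed_tile: "T \<in> \<Lambda> \<Longrightarrow> closed T"
    and convex_tile: "T \<in> \<Lambda> \<Longrightarrow> convex T"
    and star: "\<exists>d>0. \<forall>T\<in>\<Lambda>. T \<inter> ball x d \<noteq> {} \<longrightarrow> x \<in> T"
begin

lemma ex_tile: "\<exists>T\<in>\<Lambda>. x \<in> T"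
  using UNIV_I[of x] unfolding cover[symmetric] by (rule UnionE) blast

text \<open>Evaluate \<open>g\<close> at some tile through each point: by the axiom \<open>star\<close>, the resulting function is locally
  constant on the connected set.\<close>

lemma constant_along_overlaps:
  assumes "connected K"
    and g: "\<And>S T. S \<in> \<Lambda> \<Longrightarrow> T \<in> \<Lambda> \<Longrightarrow> S \<inter> T \<inter> K \<noteq> {} \<Longrightarrow> g S = g T"
    and "S \<in> \<Lambda>" "T \<in> \<Lambda>" "S \<inter> K \<noteq> {}" "T \<inter> K \<noteq> {}"
  shows "g S = g T"
proof -
  define \<tau> where "\<tau> x = (SOME T. T \<in> \<Lambda> \<and> x \<in> T)" for x
  have \<tau>: "\<tau> x \<in> \<Lambda>" "x \<in> \<tau> x" for x
    using someI_ex[of "\<lambda>T. T \<in> \<Lambda> \<and> x \<in> T"] ex_tile[of x] by (auto simp: \<tau>_def)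
  have "(\<lambda>x. g (\<tau> x)) constant_on K"
  proof (rule locally_constant_imp_constant[OF \<open>connected K\<close>])
    fix a assume a: "a \<in> K"
    obtain d where d: "d > 0" "\<And>T. T \<in> \<Lambda> \<Longrightarrow> T \<inter> ball a d \<noteq> {} \<Longrightarrow> a \<in> T" using star[of a] by blast
    have loc: "g (\<tau> x) = g (\<tau> a)" if "x \<in> K \<inter> ball a d" for x
    proof (rule g)
      have "\<tau> x \<inter> ball a d \<noteq> {}" using that \<tau>(2)[of x] by blast
      then have "a \<in> \<tau> x" by (rule d(2)[OF \<tau>(1)])
      then show "\<tau> x \<inter> \<tau> a \<inter> K \<noteq> {}" using a \<tau> by auto
    qed (use \<tau> in auto)
    show "\<exists>T. openin (top_of_set K) T \<and> a \<in> T \<and> (\<forall>x\<in>T. g (\<tau> x) = g (\<tau> a))"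
    proof (intro exI conjI ballI)
      show "openin (top_of_set K) (K \<inter> ball a d)" by (simp add: openin_open_Int)
      show "a \<in> K \<inter> ball a d" using a d(1) by simp
    qed (rule loc)
  qed
  then obtain k where k: "\<And>x. x \<in> K \<Longrightarrow> g (\<tau> x) = k" unfolding constant_on_def by metis
  have "g U = k" if U: "U \<in> \<Lambda>" "U \<inter> K \<noteq> {}" for U
  proof -
    obtain x where x: "x \<in> U" "x \<in> K" using U by auto
    then have "U \<inter> \<tau> x \<inter> K \<noteq> {}" using \<tau> by auto
    then show ?thesis using g[OF U(1) \<tau>(1)[of x]] k[OF x(2)] by metis
  qed
  from this[of S] this[of T] assms(3-6) show ?thesis by simp
qed

text \<open>Only overlaps that meet \<open>K\<close> count, so that one can work on a part of the plane with
  the same tiles.\<close>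

definition coboundary_on ::
    "(complex set \<Rightarrow> complex set \<Rightarrow> complex) \<Rightarrow> complex set \<Rightarrow> (complex set \<Rightarrow> complex) \<Rightarrow> bool" where
  "coboundary_on c K \<sigma> \<longleftrightarrow>
     (\<forall>S\<in>\<Lambda>. \<forall>T\<in>\<Lambda>. S \<inter> T \<inter> K \<noteq> {} \<longrightarrow> c S T = \<sigma> T - \<sigma> S)"

lemma coboundary_on_mono: "coboundary_on c K \<sigma> \<Longrightarrow> L \<subseteq> K \<Longrightarrow> coboundary_on c L \<sigma>"
  unfolding coboundary_on_def by blast

lemma coboundary_on_unique:
  assumes "connected K" "coboundary_on c K \<sigma>" "coboundary_on c K \<tau>"
  shows "\<exists>k. \<forall>T\<in>\<Lambda>. T \<inter> K \<noteq> {} \<longrightarrow> \<sigma> T = \<tau> T + k"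
proof (cases "\<exists>S\<in>\<Lambda>. S \<inter> K \<noteq> {}")
  case True
  then obtain S where S: "S \<in> \<Lambda>" "S \<inter> K \<noteq> {}" by blast
  have diff: "\<sigma> T - \<tau> T = \<sigma> S - \<tau> S" if "T \<in> \<Lambda>" "T \<inter> K \<noteq> {}" for T
  proof (rule constant_along_overlaps[OF assms(1) _ that(1) S(1) that(2) S(2)])
    fix U V assume "U \<in> \<Lambda>" "V \<in> \<Lambda>" "U \<inter> V \<inter> K \<noteq> {}"
    then have "c U V = \<sigma> V - \<sigma> U" "c U V = \<tau> V - \<tau> U" using assms by (auto simp: coboundary_on_def)
    then show "\<sigma> U - \<tau> U = \<sigma> V - \<tau> V" by (simp add: algebra_simps)
  qed
  have *: "\<sigma> T = \<tau> T + (\<sigma> S - \<tau> S)" if "T \<in> \<Lambda>" "T \<inter> K \<noteq> {}" for T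
    using diff[OF that] by (simp only: diff_eq_eq add.commute)
  show ?thesis by (intro exI ballI impI) (rule *)
next
  case False
  then show ?thesis by (intro exI[of _ 0]) auto
qed

text \<open>The trivialisations differ by a constant on the connected intersection and can be adjusted to agree
  there. Convexity of the union is essential: a tile that meets both parts cuts out a connected set, so it
  meets their intersection, and the two prescriptions cannot conflict.\<close>

lemma coboundary_on_Un:
  assumes K: "closed K" "convex K" and L: "closed L" "convex L" and KL: "convex (K \<union> L)"
    and "coboundary_on c K \<sigma>" "coboundary_on c L \<tau>"
  shows "\<exists>\<rho>. coboundary_on c (K \<union> L) \<rho>"
proof -
  have "connected (K \<inter> L)" using K L by (intro convex_connected convex_Int)
  moreover have "coboundary_on c (K \<inter> L) \<sigma>" by (rule coboundary_on_mono[OF assms(6)]) simp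
  moreover have "coboundary_on c (K \<inter> L) \<tau>" by (rule coboundary_on_mono[OF assms(7)]) simp
  ultimately have "\<exists>k. \<forall>T\<in>\<Lambda>. T \<inter> (K \<inter> L) \<noteq> {} \<longrightarrow> \<sigma> T = \<tau> T + k"
    by (rule coboundary_on_unique)
  then obtain k where k: "\<forall>T\<in>\<Lambda>. T \<inter> (K \<inter> L) \<noteq> {} \<longrightarrow> \<sigma> T = \<tau> T + k" ..
  define \<rho> where "\<rho> T = (if T \<inter> K \<noteq> {} then \<sigma> T else \<tau> T + k)" for T
  have \<rho>: "\<rho> T = \<tau> T + k" if T: "T \<in> \<Lambda>" "T \<inter> L \<noteq> {}" for T
  proof (cases "T \<inter> K = {}")
    case False
    have "connected (T \<inter> (K \<union> L))"
      using convex_tile[OF T(1)] KL by (intro convex_connected convex_Int)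
    moreover have "closed (T \<inter> K)" "closed (T \<inter> L)" using closed_tile[OF T(1)] K L by auto
    moreover have "T \<inter> (K \<union> L) \<subseteq> (T \<inter> K) \<union> (T \<inter> L)" by blast
    ultimately have "(T \<inter> K) \<inter> (T \<inter> L) \<inter> (T \<inter> (K \<union> L)) \<noteq> {}"
      using False T(2) connected_closedD[of "T \<inter> (K \<union> L)" "T \<inter> K" "T \<inter> L"] by blast
    then have "T \<inter> (K \<inter> L) \<noteq> {}" by blast
    then show ?thesis using k T(1) False by (simp add: \<rho>_def)
  qed (simp add: \<rho>_def)
  have "c S T = \<rho> T - \<rho> S" if "S \<in> \<Lambda>" "T \<in> \<Lambda>" "S \<inter> T \<inter> (K \<union> L) \<noteq> {}" for S T
  proof -
    from that consider "S \<inter> T \<inter> K \<noteq> {}" | "S \<inter> T \<inter> L \<noteq> {}" by blast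
    then show ?thesis
    proof cases
      case 1
      then have "\<rho> S = \<sigma> S" "\<rho> T = \<sigma> T" by (auto simp: \<rho>_def)
      then show ?thesis using assms(6) that 1 by (simp add: coboundary_on_def)
    next
      case 2
      then have "\<rho> S = \<tau> S + k" "\<rho> T = \<tau> T + k" using that by (auto intro: \<rho>)
      then show ?thesis using assms(7) that 2 by (simp add: coboundary_on_def)
    qed
  qed
  then show ?thesis unfolding coboundary_on_def by blast
qed

definition rect :: "real \<Rightarrow> real \<Rightarrow> real \<Rightarrow> real \<Rightarrow> complex set" where
  "rect a b c d = cbox (Complex a c) (Complex b d)"

lemma mem_rect: "z \<in> rect a b c d \<longleftrightarrow> a \<le> Re z \<and> Re z \<le> b \<and> c \<le> Im z \<and> Im z \<le> d"
  by (auto simp: rect_def in_cbox_complex_iff)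

lemma rect_closed_convex: "closed (rect a b c d)" "convex (rect a b c d)"
  by (auto simp: rect_def)

text \<open>The interval argument is used twice: first in the vertical direction to trivialise thin vertical slabs,
  then in the horizontal direction. Small rectangles lie in the star of one point, where the difference to a
  fixed tile through this point is a trivialisation.\<close>

lemma coboundary_on_rect:
  assumes cocycle: "\<And>S T U. S \<in> \<Lambda> \<Longrightarrow> T \<in> \<Lambda> \<Longrightarrow> U \<in> \<Lambda> \<Longrightarrow> S \<inter> T \<inter> U \<noteq> {} \<Longrightarrow> f S T + f T U = f S U"
    and "a \<le> b" "c \<le> d"
  shows "\<exists>\<sigma>. coboundary_on f (rect a b c d) \<sigma>"
proof -
  \<comment> \<open>Stacking two slabs costs only a minimum of two positive widths.\<close>
  have thin: "\<exists>e>0. \<forall>a b. a \<le> x \<and> x \<le> b \<and> b - a < e \<longrightarrow> (\<exists>\<sigma>. coboundary_on f (rect a b c d) \<sigma>)" for x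
    using \<open>c \<le> d\<close>
  proof (induction c d rule: Bolzano)
    case (trans c m d)
    from trans(1,2) obtain e e' where e: "e > 0" "e' > 0"
      "\<And>a b. a \<le> x \<Longrightarrow> x \<le> b \<Longrightarrow> b - a < e \<Longrightarrow> \<exists>\<sigma>. coboundary_on f (rect a b c m) \<sigma>"
      "\<And>a b. a \<le> x \<Longrightarrow> x \<le> b \<Longrightarrow> b - a < e' \<Longrightarrow> \<exists>\<sigma>. coboundary_on f (rect a b m d) \<sigma>"
      by blast
    have "\<exists>\<sigma>. coboundary_on f (rect a b c d) \<sigma>" if "a \<le> x" "x \<le> b" "b - a < min e e'" for a b
    proof -
      have eq: "rect a b c m \<union> rect a b m d = rect a b c d" using trans by (auto simp: mem_rect)
      have "\<exists>\<sigma>. coboundary_on f (rect a b c m) \<sigma>" by (rule e(3)) (use that in auto)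
      moreover have "\<exists>\<sigma>. coboundary_on f (rect a b m d) \<sigma>" by (rule e(4)) (use that in auto)
      ultimately obtain \<sigma> \<tau> where "coboundary_on f (rect a b c m) \<sigma>" "coboundary_on f (rect a b m d) \<tau>"
        by blast
      from coboundary_on_Un[OF rect_closed_convex rect_closed_convex _ this]
      show ?thesis by (simp add: eq rect_closed_convex)
    qed
    then show ?case using e by (intro exI[of _ "min e e'"]) auto
  next
    case (local y)
    obtain r where r: "r > 0" "\<And>T. T \<in> \<Lambda> \<Longrightarrow> T \<inter> ball (Complex x y) r \<noteq> {} \<Longrightarrow> Complex x y \<in> T"
      using star[of "Complex x y"] by blast
    obtain X where X: "X \<in> \<Lambda>" "Complex x y \<in> X" using ex_tile[of "Complex x y"] by blast
    have "coboundary_on f (rect a b c d) (f X)"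
      if ab: "a \<le> x" "x \<le> b" "b - a < r / 2" and cd: "c \<le> y" "y \<le> d" "d - c < r / 2" for a b c d
      unfolding coboundary_on_def
    proof (intro ballI impI)
      fix S T assume ST: "S \<in> \<Lambda>" "T \<in> \<Lambda>" "S \<inter> T \<inter> rect a b c d \<noteq> {}"
      have "rect a b c d \<subseteq> ball (Complex x y) r"
      proof
        fix z assume "z \<in> rect a b c d"
        then have "\<bar>Re (Complex x y - z)\<bar> < r / 2" "\<bar>Im (Complex x y - z)\<bar> < r / 2"
          using ab cd unfolding mem_rect abs_less_iff minus_complex.sel complex.sel by linarith+
        then show "z \<in> ball (Complex x y) r"
          using cmod_le[of "Complex x y - z"] by (simp add: dist_norm)
      qed
      then have "Complex x y \<in> S" "Complex x y \<in> T" using ST by (auto intro!: r)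
      then have "f X S + f S T = f X T" using X ST by (intro cocycle) auto
      then show "f S T = f X T - f X S" by (simp add: algebra_simps)
    qed
    then have "\<exists>\<sigma>. coboundary_on f (rect a b c d) \<sigma>"
      if "a \<le> x \<and> x \<le> b \<and> b - a < r / 2" "c \<le> y \<and> y \<le> d \<and> d - c < r / 2" for a b c d
      using that by blast
    moreover have "r / 2 > 0" using r(1) by simp
    ultimately show ?case by blast
  qed
  from \<open>a \<le> b\<close> show ?thesis
  proof (induction a b rule: Bolzano)
    case (trans a m b)
    have eq: "rect a m c d \<union> rect m b c d = rect a b c d" using trans by (auto simp: mem_rect)
    obtain \<sigma> \<tau> where "coboundary_on f (rect a m c d) \<sigma>" "coboundary_on f (rect m b c d) \<tau>"
      using trans by blast
    from coboundary_on_Un[OF rect_closed_convex rect_closed_convex _ this]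
    show ?case by (simp add: eq rect_closed_convex)
  next
    case (local x)
    then show ?case using thin by blast
  qed
qed

text \<open>The plane is exhausted by squares. Trivialisations that vanish at a fixed tile are compatible, as two
  of them differ by a constant on the smaller square.\<close>

theorem cocycle_is_coboundary:
  fixes f :: "complex set \<Rightarrow> complex set \<Rightarrow> complex"
  assumes cocycle: "\<And>S T U. S \<in> \<Lambda> \<Longrightarrow> T \<in> \<Lambda> \<Longrightarrow> U \<in> \<Lambda> \<Longrightarrow> S \<inter> T \<inter> U \<noteq> {} \<Longrightarrow> f S T + f T U = f S U"
  shows "\<exists>\<sigma>. \<forall>S\<in>\<Lambda>. \<forall>T\<in>\<Lambda>. S \<inter> T \<noteq> {} \<longrightarrow> f S T = \<sigma> T - \<sigma> S"
proof -
  define B where "B n = rect (- real n) (real n) (- real n) (real n)" for n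
  obtain T0 where T0: "T0 \<in> \<Lambda>" "0 \<in> T0" using ex_tile[of 0] by blast
  have T0_B: "T0 \<inter> B n \<noteq> {}" for n using T0 by (auto simp: B_def mem_rect)
  have "\<exists>\<sigma>. coboundary_on f (B n) \<sigma> \<and> \<sigma> T0 = 0" for n
  proof -
    have "\<exists>\<sigma>. coboundary_on f (B n) \<sigma>"
      unfolding B_def by (rule coboundary_on_rect[OF cocycle]) simp_all
    then obtain \<sigma> where "coboundary_on f (B n) \<sigma>" ..
    then have "coboundary_on f (B n) (\<lambda>T. \<sigma> T - \<sigma> T0)" by (simp add: coboundary_on_def)
    then show ?thesis by (intro exI[of _ "\<lambda>T. \<sigma> T - \<sigma> T0"]) simp
  qed
  then have "\<forall>n. \<exists>\<sigma>. coboundary_on f (B n) \<sigma> \<and> \<sigma> T0 = 0" ..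
  from choice[OF this] obtain \<sigma> where "\<forall>n. coboundary_on f (B n) (\<sigma> n) \<and> \<sigma> n T0 = 0" ..
  then have \<sigma>: "coboundary_on f (B n) (\<sigma> n)" "\<sigma> n T0 = 0" for n by simp_all
  have B_mono: "B m \<subseteq> B n" if "m \<le> n" for m n using that by (auto simp: B_def mem_rect)
  have agree: "\<sigma> n T = \<sigma> m T" if "m \<le> n" "T \<in> \<Lambda>" "T \<inter> B m \<noteq> {}" for m n T
  proof -
    have "connected (B m)" by (simp add: B_def rect_closed_convex convex_connected)
    then have "\<exists>k. \<forall>T\<in>\<Lambda>. T \<inter> B m \<noteq> {} \<longrightarrow> \<sigma> n T = \<sigma> m T + k"
      by (rule coboundary_on_unique[OF _ coboundary_on_mono[OF \<sigma>(1)[of n] B_mono[OF that(1)]] \<sigma>(1)])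
    then obtain k where k: "\<forall>T\<in>\<Lambda>. T \<inter> B m \<noteq> {} \<longrightarrow> \<sigma> n T = \<sigma> m T + k" ..
    have "\<sigma> n T = \<sigma> m T + k" "\<sigma> n T0 = \<sigma> m T0 + k"
      using bspec[OF k that(2)] that(3) bspec[OF k T0(1)] T0_B[of m] by blast+
    then show ?thesis by (simp add: \<sigma>(2))
  qed
  have exhaust: "\<exists>n. x \<in> B n" for x
  proof -
    obtain n where "real n \<ge> max \<bar>Re x\<bar> \<bar>Im x\<bar>" using real_arch_simple by blast
    then have "x \<in> B n" by (auto simp: B_def mem_rect)
    then show ?thesis by blast
  qed
  define N where "N T = (SOME n. T \<inter> B n \<noteq> {})" for T
  have N: "T \<inter> B (N T) \<noteq> {}" if "x \<in> T" for T x
    unfolding N_def by (rule someI_ex) (use that exhaust[of x] in blast)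
  have "f S T = \<sigma> (N T) T - \<sigma> (N S) S" if ST: "S \<in> \<Lambda>" "T \<in> \<Lambda>" and ne: "S \<inter> T \<noteq> {}" for S T
  proof -
    obtain x where x: "x \<in> S" "x \<in> T" using ne by blast
    obtain n where n: "x \<in> B n" using exhaust[of x] by blast
    define m where "m = max n (max (N S) (N T))"
    have "x \<in> B m" using n B_mono[of n m] by (auto simp: m_def)
    then have "f S T = \<sigma> m T - \<sigma> m S" using \<sigma>(1)[of m] ST x by (auto simp: coboundary_on_def)
    moreover have "\<sigma> m T = \<sigma> (N T) T" "\<sigma> m S = \<sigma> (N S) S"
      using agree[of "N T" m T] agree[of "N S" m S] ST N[OF x(1)] N[OF x(2)] by (simp_all add: m_def)
    ultimately show ?thesis by simp
  qed
  then show ?thesis by (intro exI[of _ "\<lambda>T. \<sigma> (N T) T"]) blast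
qed

end

section \<open>The cell structure of a rhombic lattice\<close>

text \<open>Up to a translation an isometry of the plane is orthogonal, hence maps balls onto balls.\<close>

lemma ball_in_isometric_set:
  assumes "isometric_sets S T" "ball c r \<subseteq> S"
  shows "\<exists>d. ball d r \<subseteq> T"
proof -
  obtain h :: "complex \<Rightarrow> complex" where h: "\<And>x y. dist (h x) (h y) = dist x y" "h ` S = T"
    using assms(1) by (auto simp: isometric_sets_def)
  define f where "f x = h x - h 0" for x
  have "orthogonal_transformation f"
    using h(1) unfolding orthogonal_transformation_isometry
    by (auto simp: f_def dist_norm)
  then have "f ` ball c r = ball (f c) r" by (rule image_orthogonal_transformation_ball)
  moreover have "h ` ball c r = (+) (h 0) ` f ` ball c r" by (simp add: image_image f_def)
  ultimately have "ball (f c + h 0) r = h ` ball c r" by (simp add: image_add_ball)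
  then show ?thesis using assms(2) h(2) by blast
qed

locale rhombic =
  fixes \<Lambda> :: "complex set set"
  assumes rhombic: "rhombic_lattice \<Lambda>"
begin

lemma unit_tile: "T \<in> \<Lambda> \<Longrightarrow> unit_rhombus T"
  using rhombic by (simp add: rhombic_lattice_def)

lemma tile_cases:
  assumes "T \<in> \<Lambda>"
  obtains p u v where "frame u v" "T = rhomb p u v"
  using unit_tile[OF assms] by (auto simp: unit_rhombus_iff)

lemma tiles_cover: "\<Union>\<Lambda> = UNIV"
  and tiles_disjoint: "S \<in> \<Lambda> \<Longrightarrow> T \<in> \<Lambda> \<Longrightarrow> S \<noteq> T \<Longrightarrow> interior S \<inter> interior T = {}"
  using rhombic by (auto simp: rhombic_lattice_def tessellation_def)

lemma tile_compact: "T \<in> \<Lambda> \<Longrightarrow> compact T"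
  and tile_convex: "T \<in> \<Lambda> \<Longrightarrow> convex T"
  by (auto elim!: tile_cases simp: rhomb_def intro: finite_imp_compact_convex_hull)

text \<open>Congruence of the tiles enters here: it bounds their inradii away from zero.\<close>

lemma ex_inradius: "\<exists>r>0. \<forall>T\<in>\<Lambda>. \<exists>c. ball c r \<subseteq> T"
proof -
  obtain S where S: "S \<in> \<Lambda>" using tiles_cover by blast
  obtain p u v where uv: "frame u v" "S = rhomb p u v" by (rule tile_cases[OF S])
  then have "interior S \<noteq> {}" using rhomb_interior[of u v "1/2" "1/2" p] by auto
  then obtain c r where "r > 0" "ball c r \<subseteq> S" by (auto simp: mem_interior)
  moreover have "isometric_sets S T" if "T \<in> \<Lambda>" for T
    using rhombic S that by (simp add: rhombic_lattice_def monohedral_def)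
  ultimately show ?thesis using ball_in_isometric_set by metis
qed

text \<open>The inscribed balls of equal radius are disjoint, so their centres are separated, and all of them
  lie within bounded distance of \<open>x\<close>.\<close>

lemma finite_tiles_near: "finite {T \<in> \<Lambda>. T \<inter> ball x 1 \<noteq> {}}" (is "finite ?F")
proof -
  obtain r where "r > 0" "\<forall>T\<in>\<Lambda>. \<exists>c. ball c r \<subseteq> T" using ex_inradius by blast
  then obtain c where r: "r > 0" and c: "\<And>T. T \<in> \<Lambda> \<Longrightarrow> ball (c T) r \<subseteq> T" by metis
  have apart: "S = T" if "S \<in> \<Lambda>" "T \<in> \<Lambda>" "dist (c S) (c T) < r" for S T
  proof (rule ccontr)
    assume "S \<noteq> T"
    then have "interior S \<inter> interior T = {}" using that tiles_disjoint by blast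
    moreover have "ball (c S) r \<subseteq> interior S" "ball (c T) r \<subseteq> interior T"
      using interior_maximal[OF c open_ball] that by blast+
    moreover have "c T \<in> ball (c S) r \<inter> ball (c T) r" using that r by auto
    ultimately show False by blast
  qed
  have "inj_on c ?F" using apart r by (intro inj_onI) auto
  moreover have "uniform_discrete (c ` ?F)"
    unfolding uniform_discrete_def using apart r by (intro exI[of _ r]) auto
  moreover have "c ` ?F \<subseteq> cball x 3"
  proof (rule image_subsetI)
    fix T assume "T \<in> ?F"
    then obtain y where T: "T \<in> \<Lambda>" and y: "y \<in> T" "y \<in> ball x 1" by blast
    have "c T \<in> T" using c[OF T] r by (meson centre_in_ball subsetD)
    then have "dist y (c T) \<le> 2" using tile_cases[OF T] y dist_rhomb_le by metis
    then show "c T \<in> cball x 3" using y dist_triangle[of x "c T" y] by auto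
  qed
  then have "bounded (c ` ?F)" using bounded_cball bounded_subset by blast
  ultimately show ?thesis using uniform_discrete_finite_iff finite_imageD by blast
qed

sublocale closed_convex_cover \<Lambda>
proof
  show "\<Union>\<Lambda> = UNIV" by (rule tiles_cover)
  show "closed T" "convex T" if "T \<in> \<Lambda>" for T
    using that tile_compact tile_convex compact_imp_closed by auto
  fix x
  define C where "C = \<Union>{T \<in> \<Lambda>. T \<inter> ball x 1 \<noteq> {} \<and> x \<notin> T}"
  have "finite {T \<in> \<Lambda>. T \<inter> ball x 1 \<noteq> {} \<and> x \<notin> T}"
    using finite_tiles_near[of x] by (rule rev_finite_subset) auto
  then have "closed C"
    unfolding C_def using tile_compact compact_imp_closed by (intro closed_Union) auto
  moreover have "x \<notin> C" by (auto simp: C_def)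
  ultimately obtain e where e: "e > 0" "ball x e \<subseteq> - C"
    by (metis ComplI closed_def open_contains_ball)
  have "x \<in> T" if T: "T \<in> \<Lambda>" "T \<inter> ball x (min 1 e) \<noteq> {}" for T
  proof (rule ccontr)
    assume "x \<notin> T"
    obtain y where y: "y \<in> T" "y \<in> ball x 1" "y \<in> ball x e" using T(2) by auto
    then have "y \<in> C" using T(1) \<open>x \<notin> T\<close> unfolding C_def by blast
    then show False using y e by blast
  qed
  then show "\<exists>d>0. \<forall>T\<in>\<Lambda>. T \<inter> ball x d \<noteq> {} \<longrightarrow> x \<in> T"
    using e(1) by (intro exI[of _ "min 1 e"]) auto
qed

text \<open>All cases of the edge-to-edge property say that the intersection is a common face.\<close>

lemma Int_face_of_tile:
  assumes "S \<in> \<Lambda>" "T \<in> \<Lambda>"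
  shows "(S \<inter> T) face_of S"
proof (cases "S = T")
  case True
  then show ?thesis using tile_convex[OF assms(1)] by (simp add: face_of_refl)
next
  case False
  have "edge_to_edge \<Lambda>" using rhombic by (simp add: rhombic_lattice_def)
  with assms False have "S \<inter> T = {} \<or> (\<exists>x. x extreme_point_of S \<and> S \<inter> T = {x}) \<or> (S \<inter> T) edge_of S"
    unfolding edge_to_edge_def by blast
  then consider "S \<inter> T = {}" | x where "x extreme_point_of S" "S \<inter> T = {x}" | "(S \<inter> T) edge_of S"
    by blast
  then show ?thesis by cases (auto simp: face_of_singleton edge_of_def)
qed

text \<open>A nonempty intersection of three tiles is a face of each of them, and any extreme point of it is a
  vertex of all three.\<close>

lemma common_vertex:
  assumes "S \<in> \<Lambda>" "T \<in> \<Lambda>" "U \<in> \<Lambda>" "S \<inter> T \<inter> U \<noteq> {}"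
  obtains p where "p extreme_point_of S" "p extreme_point_of T" "p extreme_point_of U"
proof -
  have face: "(S \<inter> T \<inter> U) face_of A" if "A \<in> {S, T, U}" for A
  proof -
    have "((A \<inter> S) \<inter> ((A \<inter> T) \<inter> (A \<inter> U))) face_of A"
      using that assms by (intro face_of_Int Int_face_of_tile) auto
    moreover have "(A \<inter> S) \<inter> ((A \<inter> T) \<inter> (A \<inter> U)) = S \<inter> T \<inter> U" using that by auto
    ultimately show ?thesis by simp
  qed
  have "compact (S \<inter> T \<inter> U)" "convex (S \<inter> T \<inter> U)"
    using assms tile_compact tile_convex by (auto intro!: compact_Int convex_Int)
  then obtain p where "p extreme_point_of (S \<inter> T \<inter> U)"
    using extreme_point_exists_convex assms(4) by blast
  then show ?thesis using that extreme_point_of_face face by blast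
qed

text \<open>The intersection is then a segment, and \<open>p\<close> and \<open>q\<close> must be its two end
  points.\<close>

lemma common_edge:
  assumes "S \<in> \<Lambda>" "T \<in> \<Lambda>" "S \<noteq> T" "p \<noteq> q"
    and "p extreme_point_of S" "q extreme_point_of S" "p extreme_point_of T" "q extreme_point_of T"
  shows "closed_segment p q edge_of S"
proof -
  have "edge_to_edge \<Lambda>" using rhombic by (simp add: rhombic_lattice_def)
  moreover have pq: "p \<in> S \<inter> T" "q \<in> S \<inter> T" using assms by (auto simp: extreme_point_of_def)
  ultimately obtain e where e: "e edge_of S" "S \<inter> T = e"
    using assms(1-4) unfolding edge_to_edge_def by (metis empty_iff singletonD)
  have F: "e face_of S" "aff_dim e = 1" using e by (auto simp: edge_of_def)
  have "compact e" "convex e"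
    using e(2) assms tile_compact tile_convex by (auto intro!: compact_Int convex_Int)
  moreover have "collinear e" using F by (simp add: collinear_aff_dim)
  ultimately obtain a b where ab: "e = closed_segment a b"
    using compact_convex_collinear_segment[of e] pq e(2) by blast
  have "p extreme_point_of e" "q extreme_point_of e"
    using extreme_point_of_face[OF F(1)] assms pq e by auto
  then have "(p = a \<and> q = b) \<or> (p = b \<and> q = a)"
    using assms(4) by (auto simp: ab extreme_point_of_segment)
  then have "e = closed_segment p q" using ab closed_segment_commute by blast
  then show ?thesis using e by simp
qed

lemma adjacent_sym: "adjacent \<Lambda> a b \<Longrightarrow> adjacent \<Lambda> b a"
  by (simp add: adjacent_def closed_segment_commute)

lemma adjacent_vertices:
  assumes "adjacent \<Lambda> a b" shows "a \<in> vertices \<Lambda>" "b \<in> vertices \<Lambda>"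
proof -
  obtain T where "T \<in> \<Lambda>" "closed_segment a b face_of T"
    using assms by (auto simp: adjacent_def edge_of_def)
  then show "a \<in> vertices \<Lambda>" "b \<in> vertices \<Lambda>"
    unfolding vertices_def using extreme_point_of_face extreme_point_of_segment by blast+
qed

lemma adjacent_norm: "adjacent \<Lambda> a b \<Longrightarrow> norm (b - a) = 1"
  unfolding adjacent_def using norm_of_edge unit_tile by blast

lemma adjacent_rhomb:
  assumes "frame u v" "rhomb p u v \<in> \<Lambda>"
  shows "adjacent \<Lambda> p (p + u)" "adjacent \<Lambda> p (p + v)"
    "adjacent \<Lambda> (p + u) (p + u + v)" "adjacent \<Lambda> (p + v) (p + u + v)"
  unfolding adjacent_def using sides_edge_of_rhomb[OF assms(1), of p] assms(2) by blast+

lemma reach_in_tile: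
  assumes "T \<in> \<Lambda>" "a extreme_point_of T" "b extreme_point_of T"
  shows "(adjacent \<Lambda>)\<^sup>*\<^sup>* a b"
proof -
  obtain p u v where uv: "frame u v" "T = rhomb p u v" by (rule tile_cases[OF assms(1)])
  have adj: "adjacent \<Lambda> p (p + u)" "adjacent \<Lambda> p (p + v)"
    "adjacent \<Lambda> (p + u) (p + u + v)" "adjacent \<Lambda> (p + v) (p + u + v)"
    using adjacent_rhomb uv assms(1) by blast+
  have p: "(adjacent \<Lambda>)\<^sup>*\<^sup>* p z \<and> (adjacent \<Lambda>)\<^sup>*\<^sup>* z p" if "z extreme_point_of T" for z
  proof -
    have z: "z \<in> {p, p + u, p + u + v, p + v}" using that uv by (simp add: extreme_point_of_rhomb)
    have "(adjacent \<Lambda>)\<^sup>*\<^sup>* p (p + u + v)" "(adjacent \<Lambda>)\<^sup>*\<^sup>* (p + u + v) p"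
      using adj adjacent_sym by (meson r_into_rtranclp rtranclp.rtrancl_into_rtrancl)+
    then show ?thesis using z adj adjacent_sym by auto
  qed
  show ?thesis using p[OF assms(2)] p[OF assms(3)] rtranclp_trans by metis
qed

text \<open>Tiles that touch share a vertex, so being within reach of \<open>a\<close> is a property that does not change from a tile
  to an overlapping one.\<close>

lemma vertices_connected:
  assumes "a \<in> vertices \<Lambda>" "b \<in> vertices \<Lambda>"
  shows "(adjacent \<Lambda>)\<^sup>*\<^sup>* a b"
proof -
  obtain S T where ST: "S \<in> \<Lambda>" "a extreme_point_of S" "T \<in> \<Lambda>" "b extreme_point_of T"
    using assms by (auto simp: vertices_def)
  define g where "g U \<longleftrightarrow> (\<exists>p. p extreme_point_of U \<and> (adjacent \<Lambda>)\<^sup>*\<^sup>* a p)" for U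
  have "g S = g T"
  proof (rule constant_along_overlaps[of UNIV])
    fix U V assume UV: "U \<in> \<Lambda>" "V \<in> \<Lambda>" "U \<inter> V \<inter> UNIV \<noteq> {}"
    then obtain q where q: "q extreme_point_of U" "q extreme_point_of V"
      using common_vertex[of U V V] by auto
    have "g W \<longleftrightarrow> (adjacent \<Lambda>)\<^sup>*\<^sup>* a q" if "W \<in> \<Lambda>" "q extreme_point_of W" for W
      unfolding g_def using reach_in_tile[OF that(1) _ that(2)] that(2) rtranclp_trans by metis
    then show "g U = g V" using UV q by simp
  qed (use ST in \<open>auto simp: extreme_point_of_def\<close>)
  moreover have "g S" using ST by (auto simp: g_def)
  ultimately obtain p where "p extreme_point_of T" "(adjacent \<Lambda>)\<^sup>*\<^sup>* a p" by (auto simp: g_def)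
  then show ?thesis using reach_in_tile[OF ST(3) _ ST(4)] rtranclp_trans by metis
qed

lemma tile_primitive:
  fixes \<omega> :: "complex \<Rightarrow> complex \<Rightarrow> complex"
  assumes anti: "\<And>a b. adjacent \<Lambda> a b \<Longrightarrow> \<omega> b a = - \<omega> a b"
    and closed: "\<And>p u v. frame u v \<Longrightarrow> rhomb p u v \<in> \<Lambda> \<Longrightarrow>
      \<omega> p (p + u) + \<omega> (p + u) (p + u + v) = \<omega> p (p + v) + \<omega> (p + v) (p + u + v)"
    and T: "T \<in> \<Lambda>"
  shows "\<exists>\<phi>. \<forall>a b. closed_segment a b edge_of T \<longrightarrow> \<omega> a b = \<phi> b - \<phi> a"
proof -
  obtain p u v where uv: "frame u v" and Tp: "T = rhomb p u v" by (rule tile_cases[OF T])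
  have ne: "u \<noteq> 0" "v \<noteq> 0" "u \<noteq> v" "u + v \<noteq> 0"
    using uv by (auto simp: frame_def add_eq_0_iff2)
  define \<phi> where "\<phi> z = (if z = p then 0 else if z = p + u then \<omega> p (p + u)
    else if z = p + v then \<omega> p (p + v) else \<omega> p (p + u) + \<omega> (p + u) (p + u + v))" for z
  have \<phi>: "\<phi> p = 0" "\<phi> (p + u) = \<omega> p (p + u)" "\<phi> (p + v) = \<omega> p (p + v)"
    "\<phi> (p + (u + v)) = \<omega> p (p + u) + \<omega> (p + u) (p + u + v)"
    using ne by (auto simp: \<phi>_def add.assoc)
  note adj = adjacent_rhomb[OF uv, of p, folded Tp, OF T]
  note A = anti[OF adj(1)] anti[OF adj(2)] anti[OF adj(3)] anti[OF adj(4)]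
  note C = closed[OF uv, of p, folded Tp, OF T]
  have "\<omega> a b = \<phi> b - \<phi> a" if e: "closed_segment a b edge_of T" for a b
    using uv e[unfolded Tp]
  proof (cases rule: edge_of_rhomb_cases)
  qed (use A C in \<open>simp_all add: \<phi> algebra_simps\<close>)
  then show ?thesis by blast
qed

text \<open>The primitives of two touching tiles differ by the same constant at all common vertices: two common
  vertices of different tiles are joined by a common edge. These constants form a cocycle, and
  subtracting a trivialisation makes the primitives match.\<close>

theorem ex_primitive:
  fixes \<omega> :: "complex \<Rightarrow> complex \<Rightarrow> complex"
  assumes anti: "\<And>a b. adjacent \<Lambda> a b \<Longrightarrow> \<omega> b a = - \<omega> a b"
    and closed: "\<And>p u v. frame u v \<Longrightarrow> rhomb p u v \<in> \<Lambda> \<Longrightarrow>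
      \<omega> p (p + u) + \<omega> (p + u) (p + u + v) = \<omega> p (p + v) + \<omega> (p + v) (p + u + v)"
  shows "\<exists>F. \<forall>a b. adjacent \<Lambda> a b \<longrightarrow> \<omega> a b = F b - F a"
proof -
  have "\<forall>T\<in>\<Lambda>. \<exists>\<phi>. \<forall>a b. closed_segment a b edge_of T \<longrightarrow> \<omega> a b = \<phi> b - \<phi> a"
    using tile_primitive[of \<omega>, OF anti closed] by blast
  from bchoice[OF this] obtain \<phi> where
    \<phi>: "\<And>T a b. T \<in> \<Lambda> \<Longrightarrow> closed_segment a b edge_of T \<Longrightarrow> \<omega> a b = \<phi> T b - \<phi> T a" by blast
  define c where "c S T = (let q = SOME q. q extreme_point_of S \<and> q extreme_point_of T in \<phi> S q - \<phi> T q)" for S T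
  have c: "c S T = \<phi> S p - \<phi> T p"
    if S: "S \<in> \<Lambda>" and T: "T \<in> \<Lambda>" and p: "p extreme_point_of S" "p extreme_point_of T" for S T p
  proof -
    define q where "q = (SOME q. q extreme_point_of S \<and> q extreme_point_of T)"
    have q: "q extreme_point_of S" "q extreme_point_of T"
      using someI_ex[of "\<lambda>q. q extreme_point_of S \<and> q extreme_point_of T"] p by (auto simp: q_def)
    have "\<phi> S q - \<phi> T q = \<phi> S p - \<phi> T p"
    proof (cases "S = T \<or> p = q")
      case False
      then have "closed_segment p q edge_of S" "closed_segment p q edge_of T"
        using common_edge S T p q by auto
      from \<phi>[OF S this(1)] \<phi>[OF T this(2)] show ?thesis by (simp add: algebra_simps)
    qed auto
    then show ?thesis by (simp add: c_def q_def Let_def)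
  qed
  have "\<exists>\<sigma>. \<forall>S\<in>\<Lambda>. \<forall>T\<in>\<Lambda>. S \<inter> T \<noteq> {} \<longrightarrow> c S T = \<sigma> T - \<sigma> S"
  proof (rule cocycle_is_coboundary)
    fix S T U assume STU: "S \<in> \<Lambda>" "T \<in> \<Lambda>" "U \<in> \<Lambda>" "S \<inter> T \<inter> U \<noteq> {}"
    then obtain p where "p extreme_point_of S" "p extreme_point_of T" "p extreme_point_of U"
      by (rule common_vertex)
    then show "c S T + c T U = c S U" using STU by (simp add: c[of _ _ p])
  qed
  then obtain \<sigma> where \<sigma>: "\<And>S T. S \<in> \<Lambda> \<Longrightarrow> T \<in> \<Lambda> \<Longrightarrow> S \<inter> T \<noteq> {} \<Longrightarrow> c S T = \<sigma> T - \<sigma> S" by blast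
  define \<tau> where "\<tau> z = (SOME T. T \<in> \<Lambda> \<and> z extreme_point_of T)" for z
  define F where "F z = \<phi> (\<tau> z) z + \<sigma> (\<tau> z)" for z
  have F: "F z = \<phi> T z + \<sigma> T" if T: "T \<in> \<Lambda>" "z extreme_point_of T" for T z
  proof -
    have \<tau>: "\<tau> z \<in> \<Lambda>" "z extreme_point_of \<tau> z"
      using someI_ex[of "\<lambda>T. T \<in> \<Lambda> \<and> z extreme_point_of T"] T by (auto simp: \<tau>_def)
    then have "\<tau> z \<inter> T \<noteq> {}" using T by (auto simp: extreme_point_of_def)
    from \<sigma>[OF \<tau>(1) T(1) this] c[OF \<tau>(1) T(1) \<tau>(2) T(2)] show ?thesis
      by (simp add: F_def algebra_simps)
  qed
  have "\<omega> a b = F b - F a" if ab: "adjacent \<Lambda> a b" for a b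
  proof -
    obtain T where T: "T \<in> \<Lambda>" "closed_segment a b edge_of T" using ab by (auto simp: adjacent_def)
    then have "a extreme_point_of T" "b extreme_point_of T"
      using extreme_point_of_face extreme_point_of_segment unfolding edge_of_def by blast+
    then show ?thesis using \<phi>[OF T] F[OF T(1)] by simp
  qed
  then show ?thesis by blast
qed

section \<open>Primitives of discrete analytic functions\<close>

lemma ex_lattice_path:
  assumes "a \<in> vertices \<Lambda>" "b \<in> vertices \<Lambda>"
  shows "\<exists>zs. lattice_path \<Lambda> a b zs"
  using vertices_connected[OF assms]
proof (induction rule: rtranclp_induct)
  case base
  show ?case using assms(1) by (intro exI[of _ "[a]"]) (simp add: lattice_path_def)
next
  case (step y z)
  then obtain zs where zs: "lattice_path \<Lambda> a y zs" by blast
  have "lattice_path \<Lambda> a z (zs @ [z])"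
    unfolding lattice_path_def
  proof (intro conjI ballI)
    fix n assume n: "n \<in> {1..<length (zs @ [z])}"
    show "adjacent \<Lambda> ((zs @ [z]) ! (n - 1)) ((zs @ [z]) ! n)"
    proof (cases "n = length zs")
      case True
      then have "(zs @ [z]) ! (n - 1) = last zs" using n zs by (auto simp: lattice_path_def nth_append last_conv_nth)
      then show ?thesis using True step zs by (simp add: lattice_path_def)
    next
      case False
      then show ?thesis using n zs by (auto simp: lattice_path_def nth_append)
    qed
  qed (use zs step adjacent_vertices in \<open>auto simp: lattice_path_def\<close>)
  then show ?case by blast
qed

definition is_primitive :: "(complex \<Rightarrow> complex) \<Rightarrow> (complex \<Rightarrow> complex) \<Rightarrow> bool" where
  "is_primitive F f \<longleftrightarrow> (\<forall>a b. adjacent \<Lambda> a b \<longrightarrow> (f a + f b) / 2 * (b - a) = F b - F a)"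

lemma path_int_primitive:
  assumes "is_primitive F f" "lattice_path \<Lambda> a b zs"
  shows "path_int f zs = F b - F a"
proof -
  let ?N = "length zs - 1"
  have zs: "zs \<noteq> []" "hd zs = a" "last zs = b" using assms(2) by (auto simp: lattice_path_def)
  have "path_int f zs = (\<Sum>n = Suc 0..?N. F (zs ! n) - F (zs ! (n - 1)))"
    unfolding path_int_def
  proof (rule sum.cong)
    fix n assume "n \<in> {Suc 0..?N}"
    then have "adjacent \<Lambda> (zs ! (n - 1)) (zs ! n)" using assms(2) by (auto simp: lattice_path_def)
    then show "(f (zs ! (n - 1)) + f (zs ! n)) / 2 * (zs ! n - zs ! (n - 1)) = F (zs ! n) - F (zs ! (n - 1))"
      using assms(1) by (simp add: is_primitive_def)
  qed simp
  also have "\<dots> = F (zs ! ?N) - F (zs ! 0)"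
    by (rule sum_telescope''[of 0 ?N "\<lambda>n. F (zs ! n)"]) simp
  finally show ?thesis using zs by (simp add: hd_conv_nth last_conv_nth)
qed

lemma discrete_int_primitive:
  assumes "is_primitive F f" "a \<in> vertices \<Lambda>" "b \<in> vertices \<Lambda>"
  shows "discrete_int \<Lambda> a b f = F b - F a"
  unfolding discrete_int_def using someI_ex[OF ex_lattice_path[OF assms(2,3)]]
  by (rule path_int_primitive[OF assms(1)])

text \<open>The vanishing of the integral round one rhombus, multiplied out: the difference quotients along
  the two diagonals agree.\<close>

definition quad_analytic :: "(complex \<Rightarrow> complex) \<Rightarrow> bool" where
  "quad_analytic f \<longleftrightarrow> (\<forall>p u v. frame u v \<longrightarrow> rhomb p u v \<in> \<Lambda> \<longrightarrow>
     (u - v) * (f (p + u + v) - f p) + (u + v) * (f (p + v) - f (p + u)) = 0)"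

lemma quad_analytic_if_DA:
  assumes "f \<in> DA \<Lambda>"
  shows "quad_analytic f"
  unfolding quad_analytic_def
proof (intro allI impI)
  fix p u v assume uv: "frame u v" "rhomb p u v \<in> \<Lambda>"
  define zs where "zs = [p, p + u, p + u + v, p + v, p]"
  note adj = adjacent_rhomb[OF uv]
  have "{1..<length zs} = {1, 2, 3, 4}" by (auto simp: zs_def)
  then have "lattice_path \<Lambda> p p zs"
    using adj adj[THEN adjacent_sym] adjacent_vertices[OF adj(1)] adjacent_vertices[OF adj(4)]
    by (simp add: lattice_path_def zs_def)
  then have "path_int f zs = 0" using assms by (auto simp: DA_def)
  moreover have "{1..length zs - 1} = {1, 2, 3, 4}" by (auto simp: zs_def)
  ultimately have "((f p + f (p + u)) * u + (f (p + u) + f (p + u + v)) * v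
      - (f (p + u + v) + f (p + v)) * u - (f (p + v) + f p) * v) / 2 = 0"
    by (simp add: path_int_def zs_def add_divide_distrib[symmetric] diff_divide_distrib[symmetric])
  then have "(f p + f (p + u)) * u + (f (p + u) + f (p + u + v)) * v
      - (f (p + u + v) + f (p + v)) * u - (f (p + v) + f p) * v = 0" by simp
  then show "(u - v) * (f (p + u + v) - f p) + (u + v) * (f (p + v) - f (p + u)) = 0"
    by algebra
qed

text \<open>The equation for one rhombus is the closedness condition of \<open>ex_primitive\<close> for the
  trapezoidal edge function, so discrete analyticity can be tested on single rhombi.\<close>

lemma ex_primitive_if_quad_analytic:
  assumes "quad_analytic f"
  shows "\<exists>F. is_primitive F f"
  unfolding is_primitive_def
proof (rule ex_primitive)
  show "(f b + f a) / 2 * (a - b) = - ((f a + f b) / 2 * (b - a))" for a b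
    by (simp add: field_simps)
  fix p u v assume "frame u v" "rhomb p u v \<in> \<Lambda>"
  then have "(u - v) * (f (p + u + v) - f p) + (u + v) * (f (p + v) - f (p + u)) = 0"
    using assms by (simp add: quad_analytic_def)
  then have "(f p + f (p + u)) * u + (f (p + u) + f (p + u + v)) * v
    = (f p + f (p + v)) * v + (f (p + v) + f (p + u + v)) * u" by algebra
  then show "(f p + f (p + u)) / 2 * (p + u - p) + (f (p + u) + f (p + u + v)) / 2 * (p + u + v - (p + u))
    = (f p + f (p + v)) / 2 * (p + v - p) + (f (p + v) + f (p + u + v)) / 2 * (p + u + v - (p + v))"
    by (simp add: add_divide_distrib[symmetric])
qed

lemma DA_if_primitive:
  assumes "f \<in> extensional (vertices \<Lambda>)" "is_primitive F f"
  shows "f \<in> DA \<Lambda>"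
  using assms path_int_primitive by (auto simp: DA_def)

lemma DA_iff_quad_analytic: "f \<in> DA \<Lambda> \<longleftrightarrow> f \<in> extensional (vertices \<Lambda>) \<and> quad_analytic f"
proof
  show "f \<in> DA \<Lambda> \<Longrightarrow> f \<in> extensional (vertices \<Lambda>) \<and> quad_analytic f"
    using quad_analytic_if_DA by (auto simp: DA_def)
qed (use ex_primitive_if_quad_analytic DA_if_primitive in blast)

text \<open>For \<open>\<mu> = 1\<close> this is the increment of the equation \<open>g = Z_plus \<Lambda> f\<close> along an edge; other values of \<open>\<mu>\<close>
  serve as a perturbation that has no exceptional edges.\<close>

definition shift_eq :: "real \<Rightarrow> (complex \<Rightarrow> complex) \<Rightarrow> (complex \<Rightarrow> complex) \<Rightarrow> bool" where
  "shift_eq \<mu> f g \<longleftrightarrow> (\<forall>a b. adjacent \<Lambda> a b \<longrightarrow>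
     f b * (b - a - of_real \<mu>) + f a * (b - a + of_real \<mu>) = 2 * (g b - g a))"

lemma shift_eq_Z_plus:
  assumes "0 \<in> vertices \<Lambda>" "f \<in> DA \<Lambda>"
  shows "shift_eq 1 f (Z_plus \<Lambda> f)" "Z_plus \<Lambda> f 0 = 0"
proof -
  obtain F where F: "is_primitive F f"
    using assms quad_analytic_if_DA ex_primitive_if_quad_analytic by blast
  have Z: "Z_plus \<Lambda> f z = (f 0 - f z) / 2 + (F z - F 0)" if "z \<in> vertices \<Lambda>" for z
    using that discrete_int_primitive[OF F assms(1) that] by (simp add: Z_plus_def)
  show "Z_plus \<Lambda> f 0 = 0" using Z assms by simp
  show "shift_eq 1 f (Z_plus \<Lambda> f)"
    unfolding shift_eq_def
  proof (intro allI impI)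
    fix a b assume ab: "adjacent \<Lambda> a b"
    then have "(f a + f b) / 2 * (b - a) = F b - F a" using F by (simp add: is_primitive_def)
    then have "(f a + f b) * (b - a) = 2 * (F b - F a)" by (simp add: field_simps)
    moreover have "2 * Z_plus \<Lambda> f z = f 0 - f z + 2 * (F z - F 0)" if "z \<in> vertices \<Lambda>" for z
      using Z[OF that] by (simp add: field_simps)
    from this[OF adjacent_vertices(1)[OF ab]] this[OF adjacent_vertices(2)[OF ab]]
    have "2 * Z_plus \<Lambda> f a = f 0 - f a + 2 * (F a - F 0)" "2 * Z_plus \<Lambda> f b = f 0 - f b + 2 * (F b - F 0)" .
    ultimately have "f b * (b - a - 1) + f a * (b - a + 1) = 2 * (Z_plus \<Lambda> f b - Z_plus \<Lambda> f a)"
      by algebra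
    then show "f b * (b - a - of_real 1) + f a * (b - a + of_real 1) = 2 * (Z_plus \<Lambda> f b - Z_plus \<Lambda> f a)"
      by simp
  qed
qed

text \<open>Solved for the trapezoidal term, the edge equation exhibits \<open>g + f / 2\<close> as a
  primitive of \<open>f\<close>.\<close>

lemma Z_plus_if_shift_eq:
  assumes "0 \<in> vertices \<Lambda>" "f \<in> extensional (vertices \<Lambda>)" "shift_eq 1 f g"
  shows "f \<in> DA \<Lambda>" "\<And>z. z \<in> vertices \<Lambda> \<Longrightarrow> Z_plus \<Lambda> f z = g z - g 0"
proof -
  have F: "is_primitive (\<lambda>z. g z + f z / 2) f"
    unfolding is_primitive_def
  proof (intro allI impI)
    fix a b assume "adjacent \<Lambda> a b"
    then have "f b * (b - a - 1) + f a * (b - a + 1) = 2 * (g b - g a)"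
      using assms(3) by (simp add: shift_eq_def)
    then have eq: "(f a + f b) * (b - a) = 2 * g b + f b - (2 * g a + f a)" by algebra
    have "(f a + f b) / 2 * (b - a) = (f a + f b) * (b - a) / 2" by simp
    also have "\<dots> = g b + f b / 2 - (g a + f a / 2)"
      unfolding eq by (simp add: add_divide_distrib diff_divide_distrib)
    finally show "(f a + f b) / 2 * (b - a) = g b + f b / 2 - (g a + f a / 2)" .
  qed
  show "f \<in> DA \<Lambda>" by (rule DA_if_primitive[OF assms(2) F])
  show "Z_plus \<Lambda> f z = g z - g 0" if "z \<in> vertices \<Lambda>" for z
    using that discrete_int_primitive[OF F assms(1) that] by (simp add: Z_plus_def diff_divide_distrib)
qed

text \<open>On one rhombus the equation for \<open>Z_plus \<Lambda> f\<close> is a linear combination of the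
  edge equations and the equation for \<open>f\<close>.\<close>

lemma Z_plus_DA:
  assumes "0 \<in> vertices \<Lambda>" "f \<in> DA \<Lambda>"
  shows "Z_plus \<Lambda> f \<in> DA \<Lambda>"
proof -
  define g where "g = Z_plus \<Lambda> f"
  have "quad_analytic g"
    unfolding quad_analytic_def
  proof (intro allI impI)
    fix p u v assume uv: "frame u v" "rhomb p u v \<in> \<Lambda>"
    have e: "f b * (b - a - 1) + f a * (b - a + 1) = 2 * (g b - g a)" if "adjacent \<Lambda> a b" for a b
      using shift_eq_Z_plus(1)[OF assms] that by (simp add: shift_eq_def g_def)
    have 1: "f (p + u) * (u - 1) + f p * (u + 1) = 2 * (g (p + u) - g p)"
      using e[OF adjacent_rhomb(1)[OF uv]] by simp
    have 2: "f (p + v) * (v - 1) + f p * (v + 1) = 2 * (g (p + v) - g p)"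
      using e[OF adjacent_rhomb(2)[OF uv]] by simp
    have 3: "f (p + u + v) * (v - 1) + f (p + u) * (v + 1) = 2 * (g (p + u + v) - g (p + u))"
      using e[OF adjacent_rhomb(3)[OF uv]] by simp
    have f: "(u - v) * (f (p + u + v) - f p) + (u + v) * (f (p + v) - f (p + u)) = 0"
      using quad_analytic_if_DA[OF assms(2)] uv by (simp add: quad_analytic_def)
    show "(u - v) * (g (p + u + v) - g p) + (u + v) * (g (p + v) - g (p + u)) = 0"
      using 1 2 3 f by algebra
  qed
  then show ?thesis
    unfolding DA_iff_quad_analytic g_def by (simp add: Z_plus_def)
qed

section \<open>The shift equation with a parameter\<close>

text \<open>Opposite sides of a rhombus have the same direction, so any odd function of the direction alone is
  closed.\<close>

lemma odd_potential:
  fixes \<theta> :: "complex \<Rightarrow> complex"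
  assumes "\<And>d. norm d = 1 \<Longrightarrow> \<theta> (- d) = - \<theta> d"
  shows "\<exists>h. \<forall>a b. adjacent \<Lambda> a b \<longrightarrow> \<theta> (b - a) = h b - h a"
proof (rule ex_primitive)
  show "\<theta> (a - b) = - \<theta> (b - a)" if "adjacent \<Lambda> a b" for a b
    using assms[OF adjacent_norm[OF that]] by simp
qed simp

lemma of_real_unit_nonzero:
  fixes d :: complex
  assumes "norm d = 1" "\<mu> > 1"
  shows "of_real \<mu> + d \<noteq> 0" "of_real \<mu> - d \<noteq> 0"
proof -
  have n: "norm (of_real \<mu> :: complex) = \<mu>" using assms(2) by simp
  show "of_real \<mu> + d \<noteq> 0"
  proof
    assume "of_real \<mu> + d = 0"
    then have "of_real \<mu> = - d" by (simp add: add_eq_0_iff2)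
    then show False using n assms by (metis less_irrefl norm_minus_cancel)
  qed
  show "of_real \<mu> - d \<noteq> 0"
  proof
    assume "of_real \<mu> - d = 0"
    then have "of_real \<mu> = d" by simp
    then show False using n assms by (metis less_irrefl)
  qed
qed

text \<open>The quotient has positive real part, so the logarithm is taken away from its branch cut and turns
  inverses into negatives.\<close>

lemma odd_Ln_quotient:
  assumes "norm d = 1" "\<mu> > 1"
  shows "Ln ((of_real \<mu> + - d) / (of_real \<mu> - - d)) = - Ln ((of_real \<mu> + d) / (of_real \<mu> - d))"
proof -
  note ne = of_real_unit_nonzero[OF assms]
  have d: "(Re d)\<^sup>2 + (Im d)\<^sup>2 = 1" using assms(1) by (simp add: cmod_def)
  let ?q = "(of_real \<mu> + d) / (of_real \<mu> - d)"
  have "Re ((of_real \<mu> + d) * cnj (of_real \<mu> - d)) = \<mu>\<^sup>2 - 1"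
    using d by (simp add: power2_eq_square algebra_simps)
  moreover have "\<mu>\<^sup>2 > 1" using assms(2) by (simp add: one_less_power)
  ultimately have "Re ?q > 0" using ne
    by (simp add: Re_complex_div_gt_0)
  then have "?q \<notin> \<real>\<^sub>\<le>\<^sub>0" by (auto simp: complex_nonpos_Reals_iff)
  then have "Ln (inverse ?q) = - Ln ?q" by (rule Ln_inverse)
  then show ?thesis by simp
qed

text \<open>The homogeneous equation multiplies by a factor that depends on the direction only; its logarithm
  is odd and has a potential.\<close>

lemma ex_discrete_exponential:
  assumes "\<mu> > 1"
  shows "\<exists>E. (\<forall>z. E z \<noteq> 0) \<and> (\<forall>a b. adjacent \<Lambda> a b \<longrightarrow>
    E b * (of_real \<mu> - (b - a)) = E a * (of_real \<mu> + (b - a)))"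
proof -
  obtain L where L: "\<And>a b. adjacent \<Lambda> a b \<Longrightarrow>
      Ln ((of_real \<mu> + (b - a)) / (of_real \<mu> - (b - a))) = L b - L a"
    using odd_potential[of "\<lambda>d. Ln ((of_real \<mu> + d) / (of_real \<mu> - d))"] odd_Ln_quotient[OF _ assms] by blast
  have "exp (L b) * (of_real \<mu> - (b - a)) = exp (L a) * (of_real \<mu> + (b - a))" if ab: "adjacent \<Lambda> a b" for a b
  proof -
    note ne = of_real_unit_nonzero[OF adjacent_norm[OF ab] assms]
    have "exp (L b) = exp (L a) * exp (L b - L a)" by (simp add: exp_diff)
    also have "exp (L b - L a) = (of_real \<mu> + (b - a)) / (of_real \<mu> - (b - a))"
      unfolding L[OF ab, symmetric] using ne by (intro exp_Ln) auto
    finally show ?thesis using ne by simp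
  qed
  then show ?thesis by (intro exI[of _ "\<lambda>z. exp (L z)"]) auto
qed

text \<open>Variation of constants: with \<open>f = E * \<phi>\<close> for a discrete exponential \<open>E\<close>, the equation prescribes the increments
  of \<open>\<phi>\<close>. Their sums along the two ways round a rhombus agree precisely because \<open>g\<close> is discrete analytic; the terms that contain \<open>\<mu>\<close> cancel.\<close>

lemma ex_perturbed_solution:
  assumes "quad_analytic g" "\<mu> > 1"
  shows "\<exists>f. f w = 0 \<and> shift_eq \<mu> f g"
proof -
  obtain E where E0: "\<And>z. E z \<noteq> 0" and
    E: "\<And>a b. adjacent \<Lambda> a b \<Longrightarrow> E b * (of_real \<mu> - (b - a)) = E a * (of_real \<mu> + (b - a))"
    using ex_discrete_exponential[OF assms(2)] by blast
  note ne = of_real_unit_nonzero[OF _ assms(2)]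
  define \<omega> where "\<omega> a b = - 2 * (g b - g a) / ((of_real \<mu> + (b - a)) * E a)" for a b
  have "\<exists>\<phi>. \<forall>a b. adjacent \<Lambda> a b \<longrightarrow> \<omega> a b = \<phi> b - \<phi> a"
  proof (rule ex_primitive)
    fix a b assume ab: "adjacent \<Lambda> a b"
    have "(of_real \<mu> + (a - b)) * E b = (of_real \<mu> + (b - a)) * E a"
      using E[OF ab] by (simp add: algebra_simps)
    then show "\<omega> b a = - \<omega> a b" by (simp add: \<omega>_def) (simp add: diff_divide_distrib algebra_simps)
  next
    fix p u v assume uv: "frame u v" "rhomb p u v \<in> \<Lambda>"
    have n: "norm u = 1" "norm v = 1" using uv by (auto simp: frame_def)
    have E1: "E (p + u) * (of_real \<mu> - u) = E p * (of_real \<mu> + u)"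
      using E[OF adjacent_rhomb(1)[OF uv]] by simp
    have E3: "E (p + v) * (of_real \<mu> - v) = E p * (of_real \<mu> + v)"
      using E[OF adjacent_rhomb(2)[OF uv]] by simp
    have E1': "E (p + u) = E p * (of_real \<mu> + u) / (of_real \<mu> - u)"
      using E1 ne n by (simp add: field_simps)
    have E3': "E (p + v) = E p * (of_real \<mu> + v) / (of_real \<mu> - v)"
      using E3 ne n by (simp add: field_simps)
    define D where "D = (of_real \<mu> + u) * (of_real \<mu> + v) * E p"
    have D: "D \<noteq> 0" using ne n E0 by (simp add: D_def)
    have q: "(u - v) * (g (p + u + v) - g p) + (u + v) * (g (p + v) - g (p + u)) = 0"
      using assms(1) uv by (simp add: quad_analytic_def)
    have r1: "- 2 * x / (m * e) = - 2 * (x * n) / (m * n * e)" if "n \<noteq> 0" for x m n e :: complex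
      using that by (cases "m = 0 \<or> e = 0") (auto simp: field_simps)
    have r2: "- 2 * x / (m * (e * k / n)) = - 2 * (x * n) / (k * m * e)" if "n \<noteq> 0" for x m n e k :: complex
      using that by (cases "m = 0 \<or> e = 0 \<or> k = 0") (auto simp: field_simps)
    have D': "D = (of_real \<mu> + v) * (of_real \<mu> + u) * E p" by (simp add: D_def mult.commute)
    have o1: "\<omega> p (p + u) = - 2 * ((g (p + u) - g p) * (of_real \<mu> + v)) / D"
      unfolding \<omega>_def D_def add_diff_cancel_left' by (rule r1[OF ne(1)[OF n(2)]])
    have o2: "\<omega> (p + u) (p + u + v) = - 2 * ((g (p + u + v) - g (p + u)) * (of_real \<mu> - u)) / D"
      unfolding \<omega>_def D_def E1' add_diff_cancel_left' by (rule r2[OF ne(2)[OF n(1)]])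
    have o3: "\<omega> p (p + v) = - 2 * ((g (p + v) - g p) * (of_real \<mu> + u)) / D"
      unfolding \<omega>_def D' add_diff_cancel_left' by (rule r1[OF ne(1)[OF n(1)]])
    have "p + u + v - (p + v) = u" by simp
    then have o4: "\<omega> (p + v) (p + u + v) = - 2 * ((g (p + u + v) - g (p + v)) * (of_real \<mu> - v)) / D"
      unfolding \<omega>_def D' E3' by (simp only:) (rule r2[OF ne(2)[OF n(2)]])
    have "(g (p + u) - g p) * (of_real \<mu> + v) + (g (p + u + v) - g (p + u)) * (of_real \<mu> - u) =
      (g (p + v) - g p) * (of_real \<mu> + u) + (g (p + u + v) - g (p + v)) * (of_real \<mu> - v)"
      using q by algebra
    then show "\<omega> p (p + u) + \<omega> (p + u) (p + u + v) = \<omega> p (p + v) + \<omega> (p + v) (p + u + v)"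
      unfolding o1 o2 o3 o4 by (metis add_divide_distrib distrib_left)
  qed
  then obtain \<phi> where \<phi>: "\<And>a b. adjacent \<Lambda> a b \<Longrightarrow> \<omega> a b = \<phi> b - \<phi> a" by blast
  define f where "f z = E z * (\<phi> z - \<phi> w)" for z
  have "shift_eq \<mu> f g"
    unfolding shift_eq_def
  proof (intro allI impI)
    fix a b assume ab: "adjacent \<Lambda> a b"
    have "\<phi> b - \<phi> a = - 2 * (g b - g a) / ((of_real \<mu> + (b - a)) * E a)"
      using \<phi>[OF ab] by (simp add: \<omega>_def)
    then have "(\<phi> b - \<phi> a) * ((of_real \<mu> + (b - a)) * E a) = - 2 * (g b - g a)"
      using ne[OF adjacent_norm[OF ab]] E0 by simp
    then show "f b * (b - a - of_real \<mu>) + f a * (b - a + of_real \<mu>) = 2 * (g b - g a)"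
      using E[OF ab] unfolding f_def by algebra
  qed
  then show ?thesis by (intro exI[of _ f]) (simp add: f_def)
qed

section \<open>Strips and heights\<close>

definition horizontal :: "complex \<Rightarrow> bool" where
  "horizontal x \<longleftrightarrow> adjacent \<Lambda> x (x + 1)"

text \<open>The edges along which the shift equation at \<open>\<mu> = 1\<close> determines the value at
  either end from the other.\<close>

definition level_step :: "complex \<Rightarrow> complex \<Rightarrow> bool" where
  "level_step a b \<longleftrightarrow> adjacent \<Lambda> a b \<and> b - a \<noteq> 1 \<and> b - a \<noteq> - 1"

abbreviation same_level :: "complex \<Rightarrow> complex \<Rightarrow> bool" where
  "same_level \<equiv> level_step\<^sup>*\<^sup>*"

lemma level_step_sym: "level_step a b \<Longrightarrow> level_step b a"
proof -
  assume *: "level_step a b"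
  then have "- (b - a) \<noteq> - 1" "- (b - a) \<noteq> - (- 1)" unfolding level_step_def neg_equal_iff_equal by auto
  then show "level_step b a" using * adjacent_sym by (simp add: level_step_def)
qed

lemma same_level_sym: "same_level a b \<Longrightarrow> same_level b a"
  using level_step_sym by (metis symp_rtranclp sympD sympI)

text \<open>A point slightly above the midpoint of the edge lies in a tile that also contains the midpoint. Its
  intersection with a tile at the edge is a face through the midpoint, so it contains the edge.\<close>

lemma ex_rhomb_above:
  assumes "horizontal x"
  shows "\<exists>v. frame 1 v \<and> rhomb x 1 v \<in> \<Lambda> \<and> Im v > 0"
proof -
  obtain T where T: "T \<in> \<Lambda>" "closed_segment x (x + 1) edge_of T"
    using assms by (auto simp: horizontal_def adjacent_def)
  have F: "closed_segment x (x + 1) face_of T" using T by (simp add: edge_of_def)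
  then have ext: "x extreme_point_of T" "(x + 1) extreme_point_of T"
    using extreme_point_of_face extreme_point_of_segment by blast+
  define m where "m = midpoint x (x + 1)"
  have m: "m \<in> open_segment x (x + 1)" by (simp add: m_def)
  have Im_m: "Im m = Im x" by (simp add: m_def midpoint_def)
  obtain d where d: "d > 0" "\<And>T. T \<in> \<Lambda> \<Longrightarrow> T \<inter> ball m d \<noteq> {} \<Longrightarrow> m \<in> T"
    using star[of m] by blast
  define q where "q = m + of_real (d / 2) * \<i>"
  have q: "q \<in> ball m d" using d by (simp add: q_def dist_norm norm_mult)
  obtain S where S: "S \<in> \<Lambda>" "q \<in> S" using ex_tile[of q] by blast
  then have mS: "m \<in> S" using d(2)[OF S(1)] q by blast
  have "closed_segment x (x + 1) edge_of S"
  proof (cases "S = T")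
    case False
    have TS: "(T \<inter> S) face_of T" "(T \<inter> S) face_of S"
      using Int_face_of_tile[OF T(1) S(1)] Int_face_of_tile[OF S(1) T(1)] by (auto simp: Int_commute)
    have "m \<in> closed_segment x (x + 1)" by (simp add: m_def)
    then have "m \<in> T" using face_of_imp_subset[OF F] by blast
    then have "x \<in> T \<inter> S \<and> x + 1 \<in> T \<inter> S"
      using face_ofD[OF TS(1) m] ext mS by (auto simp: extreme_point_of_def)
    then have "x extreme_point_of S" "(x + 1) extreme_point_of S"
      using extreme_point_of_face[OF TS(1)] extreme_point_of_face[OF TS(2)] ext by blast+
    then show ?thesis using common_edge[OF S(1) T(1) False] ext by simp
  qed (use T in simp)
  from rhombus_from_edge[OF unit_tile[OF S(1)] this]
  obtain w where w: "frame 1 w" "S = rhomb x 1 w" by (metis add_diff_cancel_left')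
  then obtain s t where st: "0 \<le> t" "q = x + of_real s * 1 + of_real t * w"
    using S(2) by (auto simp: mem_rhomb_iff)
  have "Im q = Im x + d / 2" by (simp add: q_def Im_m)
  moreover have "Im q = Im x + t * Im w" by (simp add: st)
  ultimately have "t * Im w > 0" using d by simp
  then have "Im w > 0" using st(1) by (auto simp: zero_less_mult_iff)
  then show ?thesis using w S by blast
qed

text \<open>The height of such a rhombus is at least its inradius, so that a strip cannot accumulate at a
  finite height.\<close>

lemma strip_height_bound:
  "\<exists>r>0. \<forall>x v. rhomb x 1 v \<in> \<Lambda> \<longrightarrow> Im v > 0 \<longrightarrow> r \<le> Im v"
proof -
  obtain r where r: "r > 0" "\<And>T. T \<in> \<Lambda> \<Longrightarrow> \<exists>c. ball c r \<subseteq> T" using ex_inradius by blast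
  have "r \<le> Im v" if v: "rhomb x 1 v \<in> \<Lambda>" "Im v > 0" for x v
  proof -
    obtain c where c: "ball c r \<subseteq> rhomb x 1 v" using r(2)[OF v(1)] by blast
    have strip: "Im x \<le> Im z \<and> Im z \<le> Im x + Im v" if z: "z \<in> rhomb x 1 v" for z
      using z v(2) by (auto simp: mem_rhomb_iff mult_left_le_one_le)
    have "c + of_real (r / 2) * \<i> \<in> ball c r" "c - of_real (r / 2) * \<i> \<in> ball c r"
      using r(1) by (simp_all add: dist_norm norm_mult)
    then have "c + of_real (r / 2) * \<i> \<in> rhomb x 1 v" "c - of_real (r / 2) * \<i> \<in> rhomb x 1 v"
      using c by blast+
    from strip[OF this(1)] strip[OF this(2)] show ?thesis by simp
  qed
  then show ?thesis using r(1) by blast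
qed

lemma climb_strip:
  assumes "horizontal x" "Im x \<le> c"
  shows "\<exists>y v. same_level x y \<and> same_level (x + 1) (y + 1) \<and> frame 1 v \<and> rhomb y 1 v \<in> \<Lambda> \<and>
    Im y \<le> c \<and> c < Im y + Im v"
proof -
  obtain r where r: "r > 0" "\<And>x v. rhomb x 1 v \<in> \<Lambda> \<Longrightarrow> Im v > 0 \<Longrightarrow> r \<le> Im v"
    using strip_height_bound by blast
  obtain n :: nat where "(c - Im x) / r < real n" using reals_Archimedean2 by blast
  then have "c - Im x < real n * r" using r(1) by (simp add: pos_divide_less_eq)
  with assms show ?thesis
  proof (induction n arbitrary: x)
    case 0
    then show ?case by simp
  next
    case (Suc n)
    obtain v where v: "frame 1 v" "rhomb x 1 v \<in> \<Lambda>" "Im v > 0"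
      using ex_rhomb_above[OF Suc.prems(1)] by blast
    show ?case
    proof (cases "c < Im x + Im v")
      case True
      then show ?thesis using v Suc.prems(2) by blast
    next
      case False
      have nv: "v \<noteq> 1" "v \<noteq> - 1" using v(3) by auto
      note adj = adjacent_rhomb[OF v(1,2)]
      have "horizontal (x + v)" using adj(4) by (simp add: horizontal_def add_ac)
      moreover have "c - Im (x + v) < real n * r"
        using Suc.prems(3) r(2)[OF v(2,3)] by (simp add: algebra_simps)
      ultimately obtain y v' where y: "same_level (x + v) y" "same_level (x + v + 1) (y + 1)"
        "frame 1 v'" "rhomb y 1 v' \<in> \<Lambda>" "Im y \<le> c" "c < Im y + Im v'"
        using Suc.IH[of "x + v"] False by auto
      have "level_step x (x + v)" "level_step (x + 1) (x + v + 1)"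
        using adj nv by (simp_all add: level_step_def add_ac)
      then show ?thesis using y by (meson converse_rtranclp_into_rtranclp)
    qed
  qed
qed

definition is_height :: "(complex \<Rightarrow> real) \<Rightarrow> bool" where
  "is_height h \<longleftrightarrow> (\<forall>a b. adjacent \<Lambda> a b \<longrightarrow>
     h b - h a = (if b - a = 1 then 1 else if b - a = - 1 then - 1 else 0))"

lemma ex_height: "\<exists>h. is_height h"
proof -
  define \<theta> :: "complex \<Rightarrow> complex" where "\<theta> d = (if d = 1 then 1 else if d = - 1 then - 1 else 0)" for d
  have "\<theta> (- d) = - \<theta> d" for d by (auto simp: \<theta>_def equation_minus_iff)
  then obtain h where h: "\<And>a b. adjacent \<Lambda> a b \<Longrightarrow> \<theta> (b - a) = h b - h a"
    using odd_potential[of \<theta>] by blast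
  have "is_height (\<lambda>z. Re (h z))"
    unfolding is_height_def minus_complex.sel(1)[symmetric]
    by (auto simp: h[symmetric] \<theta>_def)
  then show ?thesis by blast
qed

lemma height_same_level:
  assumes "is_height h" "same_level a b"
  shows "h a = h b"
  using assms(2)
  by (induction rule: rtranclp_induct) (use assms(1) in \<open>force simp: is_height_def level_step_def\<close>)+

text \<open>The height adds \<open>\<theta> u\<close> and \<open>\<theta> v\<close> independently along the two directions of the tile, hence is the
  restriction of an affine function. Its horizontal slope is 1 if a side of the tile is horizontal and 0
  otherwise.\<close>

lemma height_affine_on_tile:
  assumes h: "is_height h" and T: "T \<in> \<Lambda>"
  shows "\<exists>c w. 0 \<le> Re w \<and> (\<forall>q. q extreme_point_of T \<longrightarrow> h q = c + w \<bullet> q)"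
proof -
  obtain p u v where uv: "frame u v" and Tp: "T = rhomb p u v" by (rule tile_cases[OF T])
  define k where "k = Im (cnj u * v)"
  have k: "k \<noteq> 0" using frame_det_nonzero[OF uv] by (simp add: k_def)
  define \<theta> :: "complex \<Rightarrow> real" where "\<theta> d = (if d = 1 then 1 else if d = - 1 then - 1 else 0)" for d
  have step: "h b = h a + \<theta> (b - a)" if "adjacent \<Lambda> a b" for a b
  proof -
    have "h b - h a = \<theta> (b - a)" using h that unfolding is_height_def \<theta>_def by blast
    then show ?thesis by simp
  qed
  note adj = adjacent_rhomb[OF uv, of p, folded Tp, OF T]
  define w where "w = (- \<theta> u / k) *\<^sub>R (\<i> * v) + (\<theta> v / k) *\<^sub>R (\<i> * u)"
  have ii: "(\<i> * u) \<bullet> v = k" "(\<i> * v) \<bullet> u = - k" "(\<i> * u) \<bullet> u = 0" "(\<i> * v) \<bullet> v = 0"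
    by (auto simp: inner_complex_def k_def algebra_simps)
  have wu: "w \<bullet> u = \<theta> u" and wv: "w \<bullet> v = \<theta> v"
    using k by (simp_all add: w_def inner_add_left inner_diff_left ii)
  have "0 \<le> Re w"
  proof (cases "u \<in> {1, - 1} \<or> v \<in> {1, - 1}")
    case True
    then show ?thesis using wu wv by (auto simp: \<theta>_def inner_complex_def)
  next
    case False
    then show ?thesis by (simp add: w_def \<theta>_def)
  qed
  moreover have "h q = (h p - w \<bullet> p) + w \<bullet> q" if "q extreme_point_of T" for q
    using that step[OF adj(1)] step[OF adj(2)] step[OF adj(3)]
    by (auto simp: Tp extreme_point_of_rhomb[OF uv] inner_add_right wu wv)
  ultimately show ?thesis by blast
qed

text \<open>The affine extensions agree on overlaps, because the intersection of two tiles is the convex hull of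
  common vertices. Monotonicity holds within each tile, hence near each point, hence globally.\<close>

lemma ex_height_extension:
  assumes h: "is_height h"
  shows "\<exists>H. (\<forall>T\<in>\<Lambda>. \<exists>c w. (\<forall>q. q extreme_point_of T \<longrightarrow> h q = c + w \<bullet> q) \<and> (\<forall>q\<in>T. H q = c + w \<bullet> q)) \<and>
    (\<forall>q r. Im q = Im r \<longrightarrow> Re q \<le> Re r \<longrightarrow> H q \<le> H r)"
proof -
  have "\<forall>T\<in>\<Lambda>. \<exists>cw. 0 \<le> Re (snd cw) \<and> (\<forall>q. q extreme_point_of T \<longrightarrow> h q = fst cw + snd cw \<bullet> q)"
    using height_affine_on_tile[OF h] by simp
  from bchoice[OF this] obtain cw where
    cw: "\<forall>T\<in>\<Lambda>. 0 \<le> Re (snd (cw T)) \<and> (\<forall>q. q extreme_point_of T \<longrightarrow> h q = fst (cw T) + snd (cw T) \<bullet> q)" ..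
  define A where "A T q = fst (cw T) + snd (cw T) \<bullet> q" for T q
  have A_vertex: "A T q = h q" if "T \<in> \<Lambda>" "q extreme_point_of T" for T q
    using cw that by (simp add: A_def)
  have agree: "A S q = A T q" if S: "S \<in> \<Lambda>" "q \<in> S" and T: "T \<in> \<Lambda>" "q \<in> T" for S T q
  proof -
    define E where "E = {q. A S q = A T q}"
    have "E = {q. (snd (cw S) - snd (cw T)) \<bullet> q = fst (cw T) - fst (cw S)}"
      by (auto simp: E_def A_def inner_diff_left)
    then have "convex E" by (simp add: convex_hyperplane)
    have "S \<inter> T = convex hull {p. p extreme_point_of (S \<inter> T)}"
      using S T tile_compact tile_convex by (intro Krein_Milman_Minkowski) (auto intro: compact_Int convex_Int)
    also have "\<dots> \<subseteq> E"
    proof (rule hull_minimal)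
      have F: "(S \<inter> T) face_of S" "(S \<inter> T) face_of T"
        using Int_face_of_tile[OF S(1) T(1)] Int_face_of_tile[OF T(1) S(1)] by (auto simp: Int_commute)
      show "{p. p extreme_point_of (S \<inter> T)} \<subseteq> E"
      proof (rule subsetI, unfold mem_Collect_eq)
        fix p assume "p extreme_point_of (S \<inter> T)"
        then have "p extreme_point_of S" "p extreme_point_of T"
          using extreme_point_of_face[OF F(1)] extreme_point_of_face[OF F(2)] by blast+
        then show "p \<in> E" by (simp add: E_def A_vertex S(1) T(1))
      qed
    qed fact
    finally show ?thesis using S T by (auto simp: E_def)
  qed
  define \<tau> where "\<tau> q = (SOME T. T \<in> \<Lambda> \<and> q \<in> T)" for q
  have \<tau>: "\<tau> q \<in> \<Lambda>" "q \<in> \<tau> q" for q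
    using someI_ex[of "\<lambda>T. T \<in> \<Lambda> \<and> q \<in> T"] ex_tile[of q] by (auto simp: \<tau>_def)
  define H where "H q = A (\<tau> q) q" for q
  have H: "H q = A T q" if "T \<in> \<Lambda>" "q \<in> T" for T q
    unfolding H_def by (rule agree[OF \<tau> that])
  have mono_tile: "H q \<le> H r" if "T \<in> \<Lambda>" "q \<in> T" "r \<in> T" "Im q = Im r" "Re q \<le> Re r" for T q r
  proof -
    have "0 \<le> Re (snd (cw T))" using cw that by blast
    then have "A T q \<le> A T r" using that by (simp add: A_def inner_complex_def mult_left_mono)
    then show ?thesis using H that by simp
  qed
  have "H (Complex a c) \<le> H (Complex b c)" if "a \<le> b" for a b c
    using that
  proof (induction a b rule: Bolzano)
    case (trans a b c)
    then show ?case by linarith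
  next
    case (local x)
    obtain d where d: "d > 0" "\<And>T. T \<in> \<Lambda> \<Longrightarrow> T \<inter> ball (Complex x c) d \<noteq> {} \<Longrightarrow> Complex x c \<in> T"
      using star[of "Complex x c"] by blast
    have near: "Complex x c \<in> \<tau> (Complex y c)" if "\<bar>x - y\<bar> < d" for y
    proof -
      have "dist (Complex x c) (Complex y c) < d" using that by (simp add: dist_norm cmod_def)
      then show ?thesis using d(2)[OF \<tau>(1)] \<tau>(2)[of "Complex y c"] by (metis IntI empty_iff mem_ball)
    qed
    have "H (Complex a c) \<le> H (Complex b c)" if "a \<le> x" "x \<le> b" "b - a < d" for a b
    proof -
      have "\<bar>x - a\<bar> < d" "\<bar>x - b\<bar> < d" using that by auto
      then have "H (Complex a c) \<le> H (Complex x c)" "H (Complex x c) \<le> H (Complex b c)"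
        using mono_tile[OF \<tau>(1)[of "Complex a c"] \<tau>(2) near] mono_tile[OF \<tau>(1)[of "Complex b c"] near \<tau>(2)] that
        by auto
      then show ?thesis by linarith
    qed
    then show ?case using d(1) by blast
  qed
  from this[of "Re q" "Re r" "Im q" for q r]
  have "H q \<le> H r" if "Im q = Im r" "Re q \<le> Re r" for q r using that by (metis complex.collapse)
  moreover have "\<exists>c w. (\<forall>q. q extreme_point_of T \<longrightarrow> h q = c + w \<bullet> q) \<and> (\<forall>q\<in>T. H q = c + w \<bullet> q)" if "T \<in> \<Lambda>" for T
    using A_vertex[OF that] H[OF that] unfolding A_def
    by (intro exI[of _ "fst (cw T)"] exI[of _ "snd (cw T)"]) auto
  ultimately show ?thesis by blast
qed

text \<open>On a horizontal line that crosses both rhombi in their interior, the extended height rises from the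
  common value by one within each of them. As it is monotone, the two crossing segments of length one
  overlap, so the rhombi are equal.\<close>

lemma strip_unique:
  assumes h: "is_height h" "h x = h y"
    and X: "frame 1 v" "rhomb x 1 v \<in> \<Lambda>" and Y: "frame 1 w" "rhomb y 1 w \<in> \<Lambda>" "Im w > 0"
    and xy: "Im x \<le> Im y" "Im y < Im x + Im v"
  shows "x = y"
proof -
  have v: "Im v > 0" using xy by simp
  obtain H where H: "\<And>T. T \<in> \<Lambda> \<Longrightarrow> \<exists>c w. (\<forall>q. q extreme_point_of T \<longrightarrow> h q = c + w \<bullet> q) \<and> (\<forall>q\<in>T. H q = c + w \<bullet> q)"
    and H_mono: "\<And>q r. Im q = Im r \<Longrightarrow> Re q \<le> Re r \<Longrightarrow> H q \<le> H r"
    using ex_height_extension[OF h(1)] by blast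
  have H_strip: "H (z + of_real t * u) = h z \<and> H (z + of_real t * u + 1) = h z + 1"
    if u: "frame 1 u" "rhomb z 1 u \<in> \<Lambda>" "0 < t" "t < 1" for z u t
  proof -
    obtain c w where cw: "\<And>q. q extreme_point_of (rhomb z 1 u) \<Longrightarrow> h q = c + w \<bullet> q"
      "\<And>q. q \<in> rhomb z 1 u \<Longrightarrow> H q = c + w \<bullet> q" using H[OF u(2)] by blast
    have "u \<noteq> 1" "u \<noteq> - 1" using u(1) by (auto simp: frame_def)
    then have "h (z + u) = h z" "h (z + 1) = h z + 1"
      using h(1) adjacent_rhomb[OF u(1,2)] by (force simp: is_height_def)+
    then have "w \<bullet> u = 0" "w \<bullet> 1 = 1" "h z = c + w \<bullet> z"
      using cw(1)[of z] cw(1)[of "z + u"] cw(1)[of "z + 1"] u(1)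
      by (auto simp: extreme_point_of_rhomb inner_add_right)
    moreover have "z + of_real t * u \<in> rhomb z 1 u"
      unfolding mem_rhomb_iff using u by (intro exI[of _ 0] exI[of _ t]) auto
    moreover have "z + of_real t * u + 1 \<in> rhomb z 1 u"
      unfolding mem_rhomb_iff using u by (intro exI[of _ 1] exI[of _ t]) auto
    ultimately show ?thesis
      using cw(2) by (simp add: inner_add_right scaleR_conv_of_real[symmetric])
  qed
  \<comment> \<open>A height strictly inside both rhombi: \<open>Im x\<close> is at most \<open>Im y\<close>, so \<open>Im y\<close> bounds it from below.\<close>
  define c where "c = (Im y + min (Im y + Im w) (Im x + Im v)) / 2"
  have c: "Im y < c" "c < Im y + Im w" "c < Im x + Im v" using Y(3) xy by (auto simp: c_def)
  define s t where "s = (c - Im x) / Im v" and "t = (c - Im y) / Im w"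
  have s: "0 < s" "s < 1" and t: "0 < t" "t < 1"
    using c v Y(3) xy by (auto simp: s_def t_def field_simps)
  define a b where "a = x + of_real s * v" and "b = y + of_real t * w"
  have Im_ab: "Im a = c" "Im b = c" using v Y(3) by (auto simp: a_def b_def s_def t_def)
  have Ha: "H a = h x" "H (a + 1) = h x + 1" using H_strip[OF X s] by (auto simp: a_def)
  have Hb: "H b = h y" "H (b + 1) = h y + 1" using H_strip[OF Y(1,2) t] by (auto simp: b_def)
  have "\<not> Re a + 1 \<le> Re b"
    using H_mono[of "a + 1" b] Im_ab Ha Hb h(2) by auto
  moreover have "\<not> Re b + 1 \<le> Re a"
    using H_mono[of "b + 1" a] Im_ab Ha Hb h(2) by auto
  ultimately have near: "Re b < Re a + 1" "Re a < Re b + 1" by auto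
  define r where "r = (Re b - Re a + 1) / 2"
  have r: "0 < r" "r < 1" "0 < 1 - r" "1 - r < 1" using near by (auto simp: r_def)
  \<comment> \<open>A common interior point: the midpoint of the overlap of the two crossing segments.\<close>
  define m where "m = Complex ((Re a + Re b + 1) / 2) c"
  have "m = x + of_real r * 1 + of_real s * v"
    using Im_ab by (simp add: complex_eq_iff m_def r_def a_def field_simps)
  then have mX: "m \<in> interior (rhomb x 1 v)" using rhomb_interior[OF X(1) r(1,2) s] by simp
  have "m = y + of_real (1 - r) * 1 + of_real t * w"
    using Im_ab by (simp add: complex_eq_iff m_def r_def b_def field_simps)
  then have mY: "m \<in> interior (rhomb y 1 w)" using rhomb_interior[OF Y(1) r(3,4) t] by simp
  have eq: "rhomb x 1 v = rhomb y 1 w"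
    using tiles_disjoint[OF X(2) Y(2)] mX mY by blast
  have "y extreme_point_of rhomb x 1 v" "(y + 1) extreme_point_of rhomb x 1 v"
    unfolding eq using extreme_point_of_rhomb[OF Y(1)] by auto
  then have "y \<in> {x, x + 1, x + 1 + v, x + v}" "y + 1 \<in> {x, x + 1, x + 1 + v, x + v}"
    using extreme_point_of_rhomb[OF X(1)] by auto
  then show ?thesis using xy v by (auto simp: complex_eq_iff)
qed

text \<open>Climb the strip of the lower exit to the height of the other one. Climbing proceeds by level steps on both sides
  of the strip, and there \<open>strip_unique\<close> identifies the two exits.\<close>

theorem same_level_exits:
  assumes "horizontal x" "horizontal y" "same_level x y"
  shows "same_level (x + 1) (y + 1)"
proof -
  have main: "same_level (x + 1) (y + 1)"
    if xy: "horizontal x" "horizontal y" "same_level x y" "Im x \<le> Im y" for x y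
  proof -
    obtain h where h: "is_height h" using ex_height by blast
    obtain z v where z: "same_level x z" "same_level (x + 1) (z + 1)" "frame 1 v" "rhomb z 1 v \<in> \<Lambda>"
      "Im z \<le> Im y" "Im y < Im z + Im v"
      using climb_strip[OF xy(1,4)] by blast
    obtain w where w: "frame 1 w" "rhomb y 1 w \<in> \<Lambda>" "Im w > 0" using ex_rhomb_above[OF xy(2)] by blast
    have "h z = h y" using height_same_level[OF h] z(1) xy(3) by metis
    then have "z = y" using strip_unique[OF h _ z(3,4) w z(5,6)] by blast
    then show ?thesis using z(2) by simp
  qed
  show ?thesis
    using main[OF assms] main[OF assms(2,1) same_level_sym[OF assms(3)]] same_level_sym by (metis linear)
qed

section \<open>Inverting the forward shift\<close>

lemma shift_eq_step:
  assumes "shift_eq 1 f g" "adjacent \<Lambda> a b" "b - a \<noteq> 1"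
  shows "f b = (2 * (g b - g a) - f a * (b - a + 1)) / (b - a - 1)"
proof -
  have "f b * (b - a - 1) + f a * (b - a + 1) = 2 * (g b - g a)"
    using assms by (simp add: shift_eq_def)
  then have "f b * (b - a - 1) = 2 * (g b - g a) - f a * (b - a + 1)" by (simp add: algebra_simps)
  then show ?thesis using assms(3) by (simp add: nonzero_eq_divide_eq)
qed

text \<open>The coefficient of the new value tends to \<open>b - a - 1\<close>, so convergence is inherited
  along every edge except in direction 1; steps in direction \<open>- 1\<close> are allowed.\<close>

lemma perturbed_tendsto_step:
  assumes F: "\<And>n. shift_eq (1 + 1 / real (Suc n)) (F n) g"
    and ab: "adjacent \<Lambda> a b" "b - a \<noteq> 1"
    and lim: "(\<lambda>n. F n a) \<longlonglongrightarrow> c"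
  shows "(\<lambda>n. F n b) \<longlonglongrightarrow> (2 * (g b - g a) - c * (b - a + 1)) / (b - a - 1)"
proof -
  define \<mu> where "\<mu> n = 1 + 1 / real (Suc n)" for n
  have "\<mu> \<longlonglongrightarrow> 1 + 0"
    unfolding \<mu>_def using LIMSEQ_inverse_real_of_nat by (intro tendsto_add tendsto_const) (simp add: inverse_eq_divide)
  then have \<mu>: "(\<lambda>n. of_real (\<mu> n) :: complex) \<longlonglongrightarrow> 1"
    using tendsto_of_real[of \<mu> 1] by simp
  have F_b: "F n b = (2 * (g b - g a) - F n a * (b - a + of_real (\<mu> n))) / (b - a - of_real (\<mu> n))" for n
  proof -
    have "\<mu> n > 1" by (simp add: \<mu>_def)
    then have "of_real (\<mu> n) - (b - a) \<noteq> 0"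
      by (rule of_real_unit_nonzero(2)[OF adjacent_norm[OF ab(1)]])
    then have ne: "b - a - of_real (\<mu> n) \<noteq> 0" by (metis right_minus_eq)
    have "F n b * (b - a - of_real (\<mu> n)) + F n a * (b - a + of_real (\<mu> n)) = 2 * (g b - g a)"
      using F[of n] ab unfolding shift_eq_def \<mu>_def by blast
    then have "F n b * (b - a - of_real (\<mu> n)) = 2 * (g b - g a) - F n a * (b - a + of_real (\<mu> n))"
      by (simp add: algebra_simps)
    then show ?thesis using ne by (simp only: nonzero_eq_divide_eq[OF ne])
  qed
  have "b - a - 1 \<noteq> 0" using ab(2) by simp
  then show ?thesis
    unfolding F_b by (intro tendsto_intros lim \<mu>)
qed

text \<open>The values that a solution of \<open>shift_eq 1\<close> is forced to take. A relation is used because its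
  single-valuedness is the heart of the matter.\<close>

inductive determined :: "(complex \<Rightarrow> complex) \<Rightarrow> complex \<Rightarrow> complex \<Rightarrow> bool" for g where
  exit: "horizontal x \<Longrightarrow> determined g x (g (x + 1) - g x)"
| step: "determined g a c \<Longrightarrow> level_step a b \<Longrightarrow>
    determined g b ((2 * (g b - g a) - c * (b - a + 1)) / (b - a - 1))"

lemma determined_has_exit:
  assumes "determined g z c"
  shows "\<exists>x. horizontal x \<and> same_level x z"
  using assms by induction (auto intro: rtranclp.rtrancl_into_rtrancl)

text \<open>At an exit \<open>y\<close>, convergence at \<open>x + 1\<close> spreads to \<open>y + 1\<close> by \<open>same_level_exits\<close>. One step back in direction
  \<open>- 1\<close> yields the limit \<open>g (y + 1) - g y\<close>, in which the value at \<open>y + 1\<close> has the coefficient 0. Level steps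
  then propagate limits by the rule that defines \<open>determined\<close>.\<close>

lemma determined_limit:
  assumes F: "\<And>n. shift_eq (1 + 1 / real (Suc n)) (F n) g" "\<And>n. F n (x + 1) = 0"
    and x: "horizontal x"
    and z: "determined g z c" "same_level x z"
  shows "(\<lambda>n. F n z) \<longlonglongrightarrow> c"
  using z
proof (induction)
  case (exit y)
  have "same_level (x + 1) (y + 1)" by (rule same_level_exits[OF x exit(1) exit(2)])
  then have "\<exists>l. (\<lambda>n. F n (y + 1)) \<longlonglongrightarrow> l"
  proof (induction rule: rtranclp_induct)
    case base
    show ?case using F(2) by auto
  next
    case (step a b)
    then show ?case using perturbed_tendsto_step[OF F(1)] by (auto simp: level_step_def)
  qed
  then obtain l where "(\<lambda>n. F n (y + 1)) \<longlonglongrightarrow> l" by blast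
  moreover have "adjacent \<Lambda> (y + 1) y" using exit(1) adjacent_sym by (simp add: horizontal_def)
  ultimately have "(\<lambda>n. F n y) \<longlonglongrightarrow> (2 * (g y - g (y + 1)) - l * (y - (y + 1) + 1)) / (y - (y + 1) - 1)"
    using perturbed_tendsto_step[OF F(1), of "y + 1" y] by simp
  moreover have "(2 * (g y - g (y + 1)) - l * (y - (y + 1) + 1)) / (y - (y + 1) - 1) = g (y + 1) - g y"
    by (simp add: field_simps)
  ultimately show ?case by simp
next
  case (step a c b)
  have "level_step b a" by (rule level_step_sym[OF step(2)])
  then have "(\<lambda>n. F n a) \<longlonglongrightarrow> c" using step by (meson rtranclp.rtrancl_into_rtrancl)
  then show ?case
    using perturbed_tendsto_step[OF F(1)] step(2) by (simp add: level_step_def)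
qed

text \<open>Both values are the limit of one and the same sequence of perturbed solutions.\<close>

lemma determined_unique:
  assumes "quad_analytic g" "determined g z c" "determined g z d"
  shows "c = d"
proof -
  obtain x where x: "horizontal x" "same_level x z" using determined_has_exit[OF assms(2)] by blast
  have "\<forall>n. \<exists>f. f (x + 1) = 0 \<and> shift_eq (1 + 1 / real (Suc n)) f g"
    using ex_perturbed_solution[OF assms(1)] by simp
  from choice[OF this] obtain F where
    F: "\<And>n. shift_eq (1 + 1 / real (Suc n)) (F n) g" "\<And>n. F n (x + 1) = 0" by blast
  have "(\<lambda>n. F n z) \<longlonglongrightarrow> c" "(\<lambda>n. F n z) \<longlonglongrightarrow> d"
    using determined_limit[OF F x(1) _ x(2)] assms(2,3) by blast+
  then show ?thesis by (rule LIMSEQ_unique)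
qed

lemma determined_solution:
  assumes "determined g z c" "shift_eq 1 f g"
  shows "f z = c"
  using assms(1)
proof induction
  case (exit x)
  then have "f (x + 1) * (x + 1 - x - 1) + f x * (x + 1 - x + 1) = 2 * (g (x + 1) - g x)"
    using assms(2) unfolding shift_eq_def horizontal_def by (metis of_real_1)
  then have "2 * f x = 2 * (g (x + 1) - g x)" by (simp add: algebra_simps)
  then show ?case by (simp only: mult_cancel_left) simp
next
  case (step a c b)
  then show ?case using shift_eq_step[OF assms(2), of a b] by (simp add: level_step_def)
qed

end

locale rhombic_shift = rhombic +
  assumes standing: "standing_assumptions \<Lambda>"
begin

lemma zero_vertex: "0 \<in> vertices \<Lambda>"
  using standing by (simp add: standing_assumptions_def)

text \<open>The path of the second standing assumption consists of level steps up to its last edge, which is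
  the exit.\<close>

lemma ex_exit:
  assumes "z \<in> vertices \<Lambda>"
  shows "\<exists>x. horizontal x \<and> same_level z x"
proof -
  obtain N b zs where N: "N \<ge> 1" "lattice_path \<Lambda> z b zs" "length zs = N + 1"
    and steps: "\<And>n. n \<in> {1..N - 1} \<Longrightarrow> zs ! n - zs ! (n - 1) \<noteq> 1 \<and> zs ! n - zs ! (n - 1) \<noteq> - 1"
    and last: "zs ! N - zs ! (N - 1) = 1"
    using standing assms unfolding standing_assumptions_def by metis
  have z: "zs ! 0 = z" using N(2) by (metis hd_conv_nth lattice_path_def)
  have adj: "adjacent \<Lambda> (zs ! (n - 1)) (zs ! n)" if "1 \<le> n" "n \<le> N" for n
    using N(2,3) that by (auto simp: lattice_path_def)
  have "same_level z (zs ! n)" if "n \<le> N - 1" for n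
    using that
  proof (induction n)
    case 0
    then show ?case by (simp add: z)
  next
    case (Suc n)
    then have "level_step (zs ! n) (zs ! Suc n)"
      using adj[of "Suc n"] steps[of "Suc n"] by (simp add: level_step_def)
    then show ?case using Suc by (simp add: rtranclp.rtrancl_into_rtrancl)
  qed
  moreover have "zs ! N = zs ! (N - 1) + 1" using last by (simp add: algebra_simps)
  then have "horizontal (zs ! (N - 1))" using adj[of N] N(1) by (simp add: horizontal_def)
  ultimately show ?thesis by blast
qed

lemma ex_determined:
  assumes "z \<in> vertices \<Lambda>"
  shows "\<exists>c. determined g z c"
proof -
  obtain x where x: "horizontal x" "same_level z x" using ex_exit[OF assms] by blast
  have "same_level x z" by (rule same_level_sym[OF x(2)])
  then show ?thesis
    by (induction rule: rtranclp_induct) (use x(1) determined.intros in blast)+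
qed

text \<open>The determined values solve the equation: exit edges are the first rule of
  \<open>determined\<close>, level steps are the second one.\<close>

theorem Z_plus_surj:
  assumes g: "g \<in> DA \<Lambda>"
  shows "\<exists>f\<in>DA \<Lambda>. \<forall>z\<in>vertices \<Lambda>. Z_plus \<Lambda> f z = g z - g 0"
proof -
  have quad: "quad_analytic g" by (rule quad_analytic_if_DA[OF g])
  define f where "f = (\<lambda>z\<in>vertices \<Lambda>. THE c. determined g z c)"
  have f: "f z = c" if "z \<in> vertices \<Lambda>" "determined g z c" for z c
    using that determined_unique[OF quad] by (auto simp: f_def intro: the_equality)
  have det: "determined g z (f z)" if "z \<in> vertices \<Lambda>" for z
    using ex_determined[OF that] f[OF that] by metis
  have "shift_eq 1 f g"
    unfolding shift_eq_def
  proof (intro allI impI)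
    fix a b assume ab: "adjacent \<Lambda> a b"
    note V = adjacent_vertices[OF ab]
    consider "b = a + 1" | "a = b + 1" | "b - a \<noteq> 1" "b - a \<noteq> - 1" by (auto simp: algebra_simps)
    then show "f b * (b - a - of_real 1) + f a * (b - a + of_real 1) = 2 * (g b - g a)"
    proof cases
      case 1
      then have "f a = g (a + 1) - g a" using ab by (intro f V determined.exit) (simp add: horizontal_def)
      then show ?thesis using 1 by simp
    next
      case 2
      then have "horizontal b" using adjacent_sym[OF ab] by (simp add: horizontal_def)
      then have "f b = g a - g b" unfolding 2 by (intro f V determined.exit)
      moreover have "b - a = - 1" using 2 by simp
      ultimately show ?thesis by (simp add: right_diff_distrib)
    next
      case 3
      then have "f b = (2 * (g b - g a) - f a * (b - a + 1)) / (b - a - 1)"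
        using ab by (intro f V determined.step det) (simp add: level_step_def)
      moreover have "b - a - 1 \<noteq> 0" using 3 by simp
      ultimately have "f b * (b - a - 1) = 2 * (g b - g a) - f a * (b - a + 1)"
        by simp
      then show ?thesis by (simp add: algebra_simps)
    qed
  qed
  moreover have "f \<in> extensional (vertices \<Lambda>)" by (simp add: f_def)
  ultimately show ?thesis using Z_plus_if_shift_eq[OF zero_vertex] by blast
qed

theorem Z_plus_inj:
  assumes "f \<in> DA \<Lambda>" "f' \<in> DA \<Lambda>" "\<And>z. z \<in> vertices \<Lambda> \<Longrightarrow> Z_plus \<Lambda> f z = Z_plus \<Lambda> f' z"
  shows "f = f'"
proof (rule extensionalityI)
  show "f \<in> extensional (vertices \<Lambda>)" "f' \<in> extensional (vertices \<Lambda>)" using assms by (auto simp: DA_def)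
  have eq: "Z_plus \<Lambda> f = Z_plus \<Lambda> f'"
    by (rule extensionalityI[of _ "vertices \<Lambda>"]) (use assms(3) in \<open>auto simp: Z_plus_def\<close>)
  fix z assume "z \<in> vertices \<Lambda>"
  then obtain c where "determined (Z_plus \<Lambda> f) z c" using ex_determined by blast
  then show "f z = f' z"
    using determined_solution shift_eq_Z_plus(1)[OF zero_vertex assms(1)]
      shift_eq_Z_plus(1)[OF zero_vertex assms(2)] eq by metis
qed

lemma Z_minus_eqI:
  assumes "f \<in> DA \<Lambda>" "\<And>z. z \<in> vertices \<Lambda> \<Longrightarrow> Z_plus \<Lambda> f z = g z - g 0"
  shows "Z_minus \<Lambda> g = f"
  unfolding Z_minus_def
  by (rule the_equality) (use assms Z_plus_inj in auto)

lemma Z_minus: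
  assumes "g \<in> DA \<Lambda>"
  shows "Z_minus \<Lambda> g \<in> DA \<Lambda>" "z \<in> vertices \<Lambda> \<Longrightarrow> Z_plus \<Lambda> (Z_minus \<Lambda> g) z = g z - g 0"
  using Z_plus_surj[OF assms] Z_minus_eqI by blast+

lemma zero_DA: "(\<lambda>z\<in>vertices \<Lambda>. 0) \<in> DA \<Lambda>"
  and Z_plus_zero: "z \<in> vertices \<Lambda> \<Longrightarrow> Z_plus \<Lambda> (\<lambda>z\<in>vertices \<Lambda>. 0) z = 0"
proof -
  have "shift_eq 1 (\<lambda>z\<in>vertices \<Lambda>. 0) (\<lambda>_. 0)"
    using adjacent_vertices by (auto simp: shift_eq_def)
  from Z_plus_if_shift_eq[OF zero_vertex _ this] show "(\<lambda>z\<in>vertices \<Lambda>. 0) \<in> DA \<Lambda>"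
    "z \<in> vertices \<Lambda> \<Longrightarrow> Z_plus \<Lambda> (\<lambda>z\<in>vertices \<Lambda>. 0) z = 0" by auto
qed

end

theorem proposition3p4:
  fixes \<Lambda> :: "complex set set"
  assumes "rhombic_lattice \<Lambda>"
    and "standing_assumptions \<Lambda>"
  shows "Z_plus \<Lambda> \<in> DA \<Lambda> \<rightarrow> DA \<Lambda> \<and>
         Z_minus \<Lambda> \<in> DA \<Lambda> \<rightarrow> DA \<Lambda> \<and>
         (\<forall>f\<in>DA \<Lambda>. Z_minus \<Lambda> (Z_plus \<Lambda> f) = f) \<and>
         {f \<in> DA \<Lambda>. Z_minus \<Lambda> f = (\<lambda>z\<in>vertices \<Lambda>. 0)} =
         {f \<in> DA \<Lambda>. \<exists>c. \<forall>z\<in>vertices \<Lambda>. f z = c}"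
proof -
  interpret rhombic_shift \<Lambda> by unfold_locales (use assms in auto)
  \<comment> \<open>The value of \<open>Z_plus \<Lambda> f\<close> at 0 is 0, so \<open>f\<close> itself meets the condition that characterises \<open>Z_minus\<close>.\<close>
  have left_inverse: "Z_minus \<Lambda> (Z_plus \<Lambda> f) = f" if "f \<in> DA \<Lambda>" for f
    by (rule Z_minus_eqI[OF that]) (simp add: shift_eq_Z_plus(2)[OF zero_vertex that])
  have kernel: "Z_minus \<Lambda> f = (\<lambda>z\<in>vertices \<Lambda>. 0) \<longleftrightarrow> (\<exists>c. \<forall>z\<in>vertices \<Lambda>. f z = c)"
    if f: "f \<in> DA \<Lambda>" for f
  proof
    assume "Z_minus \<Lambda> f = (\<lambda>z\<in>vertices \<Lambda>. 0)"
    then have "f z = f 0" if "z \<in> vertices \<Lambda>" for z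
      using Z_minus(2)[OF f that] Z_plus_zero[OF that] by simp
    then show "\<exists>c. \<forall>z\<in>vertices \<Lambda>. f z = c" by blast
  next
    assume "\<exists>c. \<forall>z\<in>vertices \<Lambda>. f z = c"
    then have "f z - f 0 = 0" if "z \<in> vertices \<Lambda>" for z using that zero_vertex by auto
    then show "Z_minus \<Lambda> f = (\<lambda>z\<in>vertices \<Lambda>. 0)"
      by (intro Z_minus_eqI zero_DA) (simp add: Z_plus_zero)
  qed
  show ?thesis
    using Z_plus_DA[OF zero_vertex] Z_minus(1) left_inverse kernel by blast
qed

end
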